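(* Let $w,\alpha\in\mathbb{C}$ with $\operatorname{Re}(w)>-1$ and $\operatorname{Re}(\alpha)>0$. Then $$\int_{-\infty}^{\infty}\binom{w}{x}\frac{1}{x^2+\alpha^2}\,dx=\sum_{k=0}^{\infty}\binom{w}{k}\frac{1}{k^2+\alpha^2}-\frac{\pi}{\alpha\,(e^{2\pi\alpha}-1)}\left[\binom{w}{i\alpha}+\binom{w}{-i\alpha}\right].$$
   Context: For $w\in\mathbb{C}$ not a negative integer and $z\in\mathbb{C}$, the generalized binomial coefficient is $\binom{w}{z}=\frac{\Gamma(w+1)}{\Gamma(z+1)\Gamma(w-z+1)}$, where the reciprocal gamma function $1/\Gamma$ is understood as an entire function (equal to $0$ at the nonpositive integers). For an integer $k\ge 1$ one has $\binom{w}{k}=\frac{w(w-1)\cdots(w-k+1)}{k!}$, and $\binom{w}{0}=1$. *)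

theory Defs
  imports "HOL-Analysis.Analysis"
begin

text \<open>
  The library constant \<open>rGamma\<close> is the entire reciprocal Gamma function. The value is
  meaningful only when \<open>w\<close> is not a negative integer (the library sets \<open>Gamma\<close> to 0 at its
  poles).
\<close>
definition gen_binomial :: "complex \<Rightarrow> complex \<Rightarrow> complex" where
  "gen_binomial w z = Gamma (w + 1) * rGamma (z + 1) * rGamma (w - z + 1)"

lemma gen_binomial_of_nat:
  assumes "w + 1 \<notin> \<int>\<^sub>\<le>\<^sub>0"
  shows "gen_binomial w (of_nat k) = w gchoose k"
  using gbinomial_Gamma[OF assms, of k] Gamma_fact[of k, where 'a = complex]
  by (simp add: gen_binomial_def rGamma_inverse_Gamma field_simps)

end

theory Submission
  imports Defs "HOL-Complex_Analysis.Complex_Analysis" "HOL-Probability.Sinc_Integral"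
begin

text \<open>
  For Re w > -1, Cauchy's formula
  \<open>2\<pi> binom(w,z) = \<integral>\<^sub>-\<^sub>\<pi>\<^sup>\<pi> (1 + e\<^sup>i\<^sup>t)\<^sup>w e\<^sup>-\<^sup>i\<^sup>z\<^sup>t dt\<close>
  says that \<open>x \<mapsto> binom(w,x)\<close> is band-limited. By Fubini, its integral against
  \<open>1/(x\<^sup>2+\<alpha>\<^sup>2)\<close> pairs \<open>(1 + e\<^sup>i\<^sup>t)\<^sup>w\<close> with the Fourier transform
  \<open>(\<pi>/\<alpha>) exp (-\<alpha>\<bar>t\<bar>)\<close>; by Abel summation of the binomial series, the sum
  pairs it with the function \<open>C\<close> on \<open>(-\<pi>,\<pi>)\<close> whose Fourier coefficients are
  \<open>1/(k\<^sup>2+\<alpha>\<^sup>2)\<close>. The two differ by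
  \<open>(\<pi>/\<alpha>) (exp (\<alpha>t) + exp (-\<alpha>t)) / (exp (2\<pi>\<alpha>) - 1)\<close>, and
  Cauchy's formula at \<open>z = \<plusminus>i\<alpha>\<close> turns this difference into the correction term.

  Cauchy's formula itself follows from two recurrences of the integral (Pascal's rule and
  integration by parts): they express it at \<open>(w,z)\<close> through its value at
  \<open>(w+2n,z+n)\<close>, where the extra factor \<open>(2 + 2 cos t)\<^sup>n\<close> is an approximate identity.
\<close>

section \<open>Integration over one period\<close>

text \<open>The interval is open so that \<open>t \<mapsto> (1 + cis t) powr w\<close> is continuous on it for every \<open>w\<close>.\<close>

definition circ :: "real measure" where
  "circ = restrict_space lborel {-pi<..<pi}"

lemma space_circ [simp]: "space circ = {-pi<..<pi}"
  by (simp add: circ_def space_restrict_space)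

lemma measurable_circ:
  "f \<in> borel_measurable circ" if "continuous_on {-pi<..<pi} f" for f :: "real \<Rightarrow> 'a::topological_space"
proof -
  have "f \<in> borel_measurable (restrict_space borel {-pi<..<pi})"
    by (rule borel_measurable_continuous_on_restrict[OF that])
  then show ?thesis
    by (simp add: circ_def cong: measurable_cong_sets sets_restrict_space_cong)
qed

lemma finite_measure_circ: "finite_measure circ"
  by (rule finite_measureI) (simp add: circ_def emeasure_restrict_space space_restrict_space)

lemma integrable_circ_iff:
  fixes f :: "real \<Rightarrow> 'a::{banach, second_countable_topology}"
  shows "integrable circ f \<longleftrightarrow> set_integrable lborel {-pi<..<pi} f"
  unfolding circ_def set_integrable_def by (rule integrable_restrict_space) simp

text \<open>The fundamental theorem of calculus delivers gauge integrals over the closed interval,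
  and the two endpoints form a null set. Integrability on \<open>circ\<close> is a separate
  hypothesis because a gauge integral need not converge absolutely.\<close>

lemma integral_circ_eq:
  fixes f :: "real \<Rightarrow> 'a::euclidean_space"
  assumes "integrable circ f" "(f has_integral I) {-pi..pi}"
  shows "integral\<^sup>L circ f = I"
proof -
  have "integral\<^sup>L circ f = (LINT x : {-pi<..<pi} | lborel. f x)"
    unfolding circ_def set_lebesgue_integral_def by (rule integral_restrict_space) simp
  also have "\<dots> = integral {-pi<..<pi} f"
    using assms by (intro set_borel_integral_eq_integral) (simp add: integrable_circ_iff)
  also have "\<dots> = I"
    using assms has_integral_Icc_iff_Ioo integral_unique by blast
  finally show ?thesis .
qed

text \<open>For a nonnegative function gauge integrability is already absolute. Continuity supplies
  the Borel measurability needed to descend from the completion of \<open>lborel\<close>.\<close>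

lemma integrable_circ_nonneg:
  fixes f :: "real \<Rightarrow> real"
  assumes "continuous_on {-pi<..<pi} f" "f integrable_on {-pi..pi}"
    and "\<And>x. x \<in> {-pi<..<pi} \<Longrightarrow> f x \<ge> 0"
  shows "integrable circ f"
proof -
  have "f absolutely_integrable_on {-pi<..<pi}"
    using assms by (intro nonnegative_absolutely_integrable_1) (auto simp: integrable_on_Icc_iff_Ioo)
  then have "integrable (completion lborel) (\<lambda>x. indicator {-pi<..<pi} x *\<^sub>R f x)"
    by (simp add: set_integrable_def)
  moreover have "(\<lambda>x. indicator {-pi<..<pi} x *\<^sub>R f x) \<in> borel_measurable lborel"
    using borel_measurable_continuous_on_indicator[OF _ assms(1)] by simp
  ultimately show ?thesis
    by (simp add: integrable_circ_iff set_integrable_def integrable_completion)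
qed

lemma integrable_circ_mult_bounded:
  fixes f g :: "real \<Rightarrow> complex"
  assumes "integrable circ f" "continuous_on {-pi..pi} g"
  shows "integrable circ (\<lambda>t. f t * g t)"
proof -
  have "compact (g ` {-pi..pi})"
    using assms(2) by (intro compact_continuous_image) auto
  then obtain B where B: "\<And>t. t \<in> {-pi..pi} \<Longrightarrow> norm (g t) \<le> B"
    by (meson bounded_iff compact_imp_bounded imageI)
  show ?thesis
  proof (rule Bochner_Integration.integrable_bound)
    show "integrable circ (\<lambda>t. B *\<^sub>R f t)" using assms(1) by simp
    have "g \<in> borel_measurable circ"
      using assms(2) by (intro measurable_circ) (auto intro: continuous_on_subset)
    then show "(\<lambda>t. f t * g t) \<in> borel_measurable circ" using assms(1) by measurable
    show "AE t in circ. norm (f t * g t) \<le> norm (B *\<^sub>R f t)"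
    proof (rule AE_I2)
      fix t assume "t \<in> space circ"
      then have "norm (g t) \<le> B" by (intro B) auto
      then have "norm (g t) \<le> \<bar>B\<bar>" by linarith
      then show "norm (f t * g t) \<le> norm (B *\<^sub>R f t)"
        by (simp add: norm_mult mult.commute[of "norm (f t)"] mult_right_mono)
    qed
  qed
qed

lemma integrable_circ_continuous:
  fixes g :: "real \<Rightarrow> complex"
  assumes "continuous_on {-pi..pi} g"
  shows "integrable circ g"
proof -
  have "integrable circ (\<lambda>_. 1 :: complex)"
    by (rule finite_measure.integrable_const[OF finite_measure_circ])
  then show ?thesis using integrable_circ_mult_bounded[of "\<lambda>_. 1" g] assms by simp
qed

section \<open>Powers of \<open>cos (t / 2)\<close> and the kernel
  \<open>(1 + cis t) powr w\<close>\<close>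

lemma cos_half_pos: "cos (t / 2) > 0" if "t \<in> {-pi<..<pi}"
  using that by (intro cos_gt_zero_pi) auto

text \<open>For negative \<open>a\<close> the function blows up at both endpoints. The bound
  \<open>a > -1\<close> makes the primitive \<open>G\<close> continuous up to them, and makes the
  coefficient \<open>a + 1\<close> nonzero when the identity is solved for the integrand.\<close>

lemma integrable_circ_cos_powr:
  fixes a :: real
  assumes "a > -1"
  shows "integrable circ (\<lambda>t. cos (t / 2) powr a)"
proof (rule integrable_circ_nonneg)
  show "continuous_on {-pi<..<pi} (\<lambda>t. cos (t / 2) powr a)"
    by (intro continuous_intros) (use cos_half_pos in force)+
  \<comment> \<open>The derivative of \<open>G\<close> reduces the exponent \<open>a\<close> to the harmless \<open>a + 2\<close>.\<close>
  define G where "G = (\<lambda>t. sin (t / 2) * cos (t / 2) powr (a + 1))"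
  define g where "g = (\<lambda>t. (a + 2) / 2 * cos (t / 2) powr (a + 2) - (a + 1) / 2 * cos (t / 2) powr a)"
  have "(g has_integral G pi - G (-pi)) {-pi..pi}"
  proof (rule fundamental_theorem_of_calculus_interior)
    show "continuous_on {-pi..pi} G"
      unfolding G_def
      by (intro continuous_intros continuous_on_powr') (use assms in \<open>auto intro!: cos_ge_zero\<close>)
    fix t assume t: "t \<in> {-pi<..<pi}"
    have c: "cos (t / 2) > 0" using cos_half_pos[OF t] .
    have "(G has_real_derivative
        1 / 2 * cos (t / 2) * cos (t / 2) powr (a + 1)
        - (a + 1) / 2 * cos (t / 2) powr a * (sin (t / 2))\<^sup>2) (at t)"
      unfolding G_def using c
      by (auto intro!: derivative_eq_intros simp: power2_eq_square)
    moreover have "cos (t / 2) * cos (t / 2) powr (a + 1) = cos (t / 2) powr (a + 2)"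
      using c powr_add[of "cos (t/2)" 1 "a + 1"] by (simp add: add.commute)
    moreover have "cos (t / 2) powr a * (sin (t / 2))\<^sup>2 = cos (t / 2) powr a - cos (t / 2) powr (a + 2)"
      using c powr_add[of "cos (t/2)" a 2] by (simp add: sin_squared_eq algebra_simps)
    ultimately have "(G has_real_derivative g t) (at t)"
      by (simp add: g_def mult.assoc) (simp add: algebra_simps add_divide_distrib diff_divide_distrib)
    then show "(G has_vector_derivative g t) (at t)"
      by (simp add: has_real_derivative_iff_has_vector_derivative)
  qed auto
  then have "g integrable_on {-pi..pi}" by blast
  moreover have "(\<lambda>t. cos (t / 2) powr (a + 2)) integrable_on {-pi..pi}"
    by (intro integrable_continuous_real continuous_intros continuous_on_powr') (use assms in \<open>auto intro!: cos_ge_zero\<close>)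
  then have "(\<lambda>t. (a + 2) / 2 * cos (t / 2) powr (a + 2)) integrable_on {-pi..pi}"
    using integrable_on_cmult_left[of _ _ "(a + 2) / 2"] by fastforce
  ultimately have "(\<lambda>t. (a + 2) / 2 * cos (t / 2) powr (a + 2) - g t) integrable_on {-pi..pi}"
    using integrable_diff by blast
  then have "(\<lambda>t. (a + 1) / 2 * cos (t / 2) powr a) integrable_on {-pi..pi}"
    by (simp add: g_def)
  then show "(\<lambda>t. cos (t / 2) powr a) integrable_on {-pi..pi}"
    using assms integrable_on_cmult_left_iff[of "(a + 1) / 2" "\<lambda>t. cos (t / 2) powr a" "{-pi..pi}"] by simp
qed auto

lemma one_plus_cis: "1 + cis t = of_real (2 * cos (t / 2)) * cis (t / 2)"
proof -
  have "cis t = cis (t/2) ^ 2" by (simp add: Complex.DeMoivre)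
  moreover have "1 = cis (t/2) * cis (-(t/2))" by (simp add: cis_mult)
  ultimately have "1 + cis t = cis (t/2) * (cis (t/2) + cis (-(t/2)))" by (simp add: power2_eq_square algebra_simps)
  also have "cis (t/2) + cis (-(t/2)) = of_real (2 * cos (t / 2))" by (simp add: complex_eq_iff)
  finally show ?thesis by (simp add: mult.commute)
qed

lemma norm_one_plus_cis: "norm (1 + cis t) = 2 * cos (t / 2)" if "t \<in> {-pi<..<pi}"
  using cos_half_pos[OF that] by (simp only: one_plus_cis norm_mult) simp

text \<open>A nonpositive real value forces \<open>sin t = 0\<close> and then
  \<open>cos t = -1\<close>, which happens only at the excluded endpoints. The radius
  \<open>r\<close> covers the kernel itself (\<open>r = 1\<close>) and its Abel means
  (\<open>r < 1\<close>).\<close>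

lemma one_plus_cis_notin: "1 + of_real r * cis t \<notin> \<real>\<^sub>\<le>\<^sub>0" if "t \<in> {-pi<..<pi}" "0 \<le> r" "r \<le> 1"
proof
  assume "1 + of_real r * cis t \<in> \<real>\<^sub>\<le>\<^sub>0"
  then have A: "1 + r * cos t \<le> 0" "r * sin t = 0" by (auto simp: complex_nonpos_Reals_iff)
  then have "r \<noteq> 0" by auto
  with A have s: "sin t = 0" by auto
  then have "cos t = 1 \<or> cos t = -1"
    using sin_cos_squared_add[of t] by (simp add: power2_eq_1_iff)
  with A that have "cos t = -1" by auto
  moreover have "cos t = 2 * (cos (t/2))\<^sup>2 - 1" using cos_double_cos[of "t/2"] by simp
  ultimately show False using cos_half_pos[OF that(1)] by auto
qed

lemma continuous_on_binomial_kernel: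
  assumes "0 \<le> r" "r \<le> 1"
  shows "continuous_on {-pi<..<pi} (\<lambda>t. (1 + of_real r * cis t) powr w)"
  unfolding continuous_on_def
  by (intro ballI tendsto_powr_complex tendsto_intros one_plus_cis_notin assms) auto

text \<open>The modulus of the power is \<open>norm z powr Re w * exp (- Im w * Arg z)\<close>, and
  the argument is bounded by \<open>pi\<close>. Up to a constant only \<open>Re w\<close>
  matters.\<close>

lemma norm_powr_complex_le: "norm (z powr w) \<le> exp (\<bar>Im w\<bar> * pi) * norm z powr Re w" for z w :: complex
proof -
  have "- Im w * Arg z \<le> \<bar>- Im w * Arg z\<bar>" by (rule abs_ge_self)
  also have "\<dots> = \<bar>Im w\<bar> * \<bar>Arg z\<bar>" by (simp add: abs_mult)
  also have "\<dots> \<le> \<bar>Im w\<bar> * pi"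
    using Arg_le_pi[of z] mpi_less_Arg[of z] by (intro mult_left_mono) auto
  finally have "exp (- Im w * Arg z) \<le> exp (\<bar>Im w\<bar> * pi)" by simp
  then have "norm z powr Re w * exp (- Im w * Arg z) \<le> norm z powr Re w * exp (\<bar>Im w\<bar> * pi)"
    by (rule mult_left_mono) simp
  then show ?thesis by (simp add: norm_powr_complex mult.commute)
qed

lemma integrable_binomial_kernel:
  assumes "Re w > -1"
  shows "integrable circ (\<lambda>t. (1 + cis t) powr w)"
proof (rule Bochner_Integration.integrable_bound)
  show "integrable circ (\<lambda>t. (2 powr Re w * exp (\<bar>Im w\<bar> * pi)) * cos (t/2) powr Re w)"
    using integrable_circ_cos_powr[OF assms] by simp
  show "(\<lambda>t. (1 + cis t) powr w) \<in> borel_measurable circ"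
    using measurable_circ[OF continuous_on_binomial_kernel[of 1 w]] by simp
  show "AE t in circ. norm ((1 + cis t) powr w)
     \<le> norm ((2 powr Re w * exp (\<bar>Im w\<bar> * pi)) * cos (t/2) powr Re w)"
  proof (rule AE_I2)
    fix t assume t: "t \<in> space circ"
    then have c: "cos (t/2) > 0" using cos_half_pos by simp
    show "norm ((1 + cis t) powr w) \<le> norm ((2 powr Re w * exp (\<bar>Im w\<bar> * pi)) * cos (t/2) powr Re w)"
      using norm_powr_complex_le[of "1 + cis t" w] t c
      by (simp add: norm_one_plus_cis powr_mult abs_mult mult_ac)
  qed
qed

section \<open>The Fourier integral of the binomial coefficient\<close>

text \<open>For \<open>Re w > -1\<close> this is \<open>2 * pi * gen_binomial w z\<close>, as
  \<open>binomial_integral_eq\<close> shows. The argument \<open>z\<close> is complex because the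
  correction term needs the values at \<open>\<i> * \<alpha>\<close> and
  \<open>- \<i> * \<alpha>\<close>.\<close>

definition binomial_integral :: "complex \<Rightarrow> complex \<Rightarrow> complex" where
  "binomial_integral w z = (\<integral>t. (1 + cis t) powr w * exp (-(\<i> * z * of_real t)) \<partial>circ)"

lemma integrable_binomial_integral:
  assumes "Re w > -1"
  shows "integrable circ (\<lambda>t. (1 + cis t) powr w * exp (-(\<i> * z * of_real t)))"
  by (intro integrable_circ_mult_bounded integrable_binomial_kernel assms continuous_intros)

lemma one_plus_cis_nz: "1 + cis t \<noteq> 0" if "t \<in> {-pi<..<pi}"
  using one_plus_cis_notin[OF that, of 1] by auto

section \<open>Recurrences of the integral\<close>

text \<open>Lowering \<open>z\<close> by one multiplies the integrand by \<open>cis t\<close>, so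
  the two integrands on the right add up to one with an extra factor
  \<open>1 + cis t\<close>.\<close>

lemma binomial_integral_Pascal:
  assumes "Re w > -1"
  shows "binomial_integral (w + 1) z = binomial_integral w z + binomial_integral w (z - 1)"
proof -
  have "binomial_integral w z + binomial_integral w (z - 1) =
    (\<integral>t. (1 + cis t) powr w * exp (-(\<i> * z * of_real t)) + (1 + cis t) powr w * exp (-(\<i> * (z - 1) * of_real t)) \<partial>circ)"
    unfolding binomial_integral_def
    by (intro Bochner_Integration.integral_add[symmetric] integrable_binomial_integral assms)
  also have "\<dots> = binomial_integral (w + 1) z"
    unfolding binomial_integral_def
  proof (intro Bochner_Integration.integral_cong refl)
    fix t assume "t \<in> space circ"
    then have nz: "1 + cis t \<noteq> 0" by (intro one_plus_cis_nz) simp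
    have "exp (-(\<i> * (z - 1) * of_real t)) = cis t * exp (-(\<i> * z * of_real t))"
      by (simp add: cis_conv_exp algebra_simps flip: exp_add)
    then show "(1 + cis t) powr w * exp (-(\<i> * z * of_real t)) + (1 + cis t) powr w * exp (-(\<i> * (z - 1) * of_real t))
      = (1 + cis t) powr (w + 1) * exp (-(\<i> * z * of_real t))"
      using nz by (simp add: powr_add algebra_simps)
  qed
  finally show ?thesis ..
qed

text \<open>Integration by parts: the primitive
  \<open>(1 + cis t) powr (w + 1) * exp (-(\<i> * z * t))\<close> vanishes at both endpoints, so its
  derivative integrates to 0. This is the analogue of the absorption identity k binom(n,k) = n
  binom(n-1,k-1).\<close>

lemma binomial_integral_absorb:
  assumes "Re w > -1"
  shows "(w + 1) * binomial_integral w (z - 1) = z * binomial_integral (w + 1) z"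
proof -
  define g where "g = (\<lambda>t. \<i> * (w + 1) * ((1 + cis t) powr w * exp (-(\<i> * (z - 1) * of_real t)))
     - \<i> * z * ((1 + cis t) powr (w + 1) * exp (-(\<i> * z * of_real t))))"
  define G where "G = (\<lambda>t::real. (1 + cis t) powr (w + 1) * exp (-(\<i> * z * of_real t)))"
  have int: "integrable circ (\<lambda>t. \<i> * (w + 1) * ((1 + cis t) powr w * exp (-(\<i> * (z - 1) * of_real t))))"
       "integrable circ (\<lambda>t. \<i> * z * ((1 + cis t) powr (w + 1) * exp (-(\<i> * z * of_real t))))"
    using integrable_binomial_integral[of w "z - 1"] integrable_binomial_integral[of "w + 1" z] assms by auto
  have "(g has_integral G pi - G (-pi)) {-pi..pi}"
  proof (rule fundamental_theorem_of_calculus_interior)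
    show "continuous_on {-pi..pi} G"
      unfolding continuous_on_def
    proof
      fix t assume t: "t \<in> {-pi..pi}"
      \<comment> \<open>At the endpoints the base is 0 and lies on the branch cut; there the
        positive real part of the exponent keeps the power continuous.\<close>
      have "1 + cis t \<notin> \<real>\<^sub>\<le>\<^sub>0 \<or> 1 + cis t = 0 \<and> Re (w + 1) > 0"
      proof (cases "t \<in> {-pi<..<pi}")
        case True
        then show ?thesis using one_plus_cis_notin[of t 1] by simp
      next
        case False
        with t have "t = pi \<or> t = -pi" by auto
        with assms show ?thesis by (auto simp: complex_eq_iff)
      qed
      then show "(G \<longlongrightarrow> G t) (at t within {-pi..pi})"
        unfolding G_def by (intro tendsto_intros tendsto_powr_complex') auto
    qed
    fix t assume t: "t \<in> {-pi<..<pi}"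
    have notin: "1 + exp (\<i> * of_real t) \<notin> \<real>\<^sub>\<le>\<^sub>0"
      using one_plus_cis_notin[OF t, of 1] by (simp add: cis_conv_exp)
    have "((\<lambda>s. (1 + exp (\<i> * s)) powr (w + 1) * exp (-(\<i> * z * s))) has_field_derivative
       ((w + 1) * (1 + exp (\<i> * t)) powr w * (exp (\<i> * t) * \<i>)) * exp (-(\<i> * z * t))
        + (exp (-(\<i> * z * t)) * -(\<i> * z)) * (1 + exp (\<i> * t)) powr (w + 1)) (at (of_real t))"
      using notin by (auto intro!: derivative_eq_intros has_field_derivative_powr[THEN DERIV_chain2])
    also have "((w + 1) * (1 + exp (\<i> * t)) powr w * (exp (\<i> * t) * \<i>)) * exp (-(\<i> * z * t))
        + (exp (-(\<i> * z * t)) * -(\<i> * z)) * (1 + exp (\<i> * t)) powr (w + 1) = g t"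
    proof -
      have "exp (-(\<i> * (z - 1) * of_real t)) = exp (\<i> * t) * exp (-(\<i> * z * of_real t))"
        by (simp add: algebra_simps flip: exp_add)
      then show ?thesis by (simp add: g_def cis_conv_exp algebra_simps)
    qed
    finally show "(G has_vector_derivative g t) (at t)"
      unfolding G_def cis_conv_exp
      by (rule has_vector_derivative_real_field[where f="\<lambda>s. (1 + exp (\<i> * s)) powr (w + 1) * exp (-(\<i> * z * s))"])
  qed auto
  moreover have "G pi = 0" "G (-pi) = 0" by (auto simp: G_def complex_eq_iff cis_conv_exp exp_minus)
  moreover have "integrable circ g" unfolding g_def using int by simp
  ultimately have "integral\<^sup>L circ g = 0" using integral_circ_eq by fastforce
  moreover have "integral\<^sup>L circ g = \<i> * (w + 1) * binomial_integral w (z - 1) - \<i> * z * binomial_integral (w + 1) z"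
    unfolding g_def binomial_integral_def
    by (subst Bochner_Integration.integral_diff[OF int]) simp
  ultimately show ?thesis by (simp add: mult.assoc flip: right_diff_distrib)
qed

text \<open>Writing B for the integral, Pascal's rule and absorption give (w+1) B(w,z) = (w-z+1)
  B(w+1,z). Absorption at (w+1,z+1) then raises both arguments.\<close>

lemma binomial_integral_step:
  assumes "Re w > -1"
  shows "(w + 1) * (w + 2) * binomial_integral w z
    = (z + 1) * (w - z + 1) * binomial_integral (w + 2) (z + 1)"
proof -
  have "(w + 1) * binomial_integral w z = (w - z + 1) * binomial_integral (w + 1) z"
    using binomial_integral_Pascal[OF assms, of z] binomial_integral_absorb[OF assms, of z]
    by (simp add: algebra_simps)
  moreover have "(w + 2) * binomial_integral (w + 1) z = (z + 1) * binomial_integral (w + 2) (z + 1)"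
    using binomial_integral_absorb[of "w + 1" "z + 1"] assms by (simp add: algebra_simps)
  ultimately have "(w + 2) * ((w + 1) * binomial_integral w z) = (w - z + 1) * ((z + 1) * binomial_integral (w + 2) (z + 1))"
    by (simp add: mult.left_commute)
  then show ?thesis by (simp only: mult_ac)
qed

lemma binomial_integral_shift:
  assumes "Re w > -1"
  shows "pochhammer (w + 1) (2 * n) * binomial_integral w z
    = pochhammer (z + 1) n * pochhammer (w - z + 1) n * binomial_integral (w + of_nat (2 * n)) (z + of_nat n)"
proof (induction n)
  case (Suc n)
  let ?W = "w + of_nat (2 * n)" and ?Z = "z + of_nat n"
  have "pochhammer (w + 1) (2 * Suc n) = pochhammer (w + 1) (2 * n) * ((?W + 1) * (?W + 2))"
    by (simp add: pochhammer_Suc algebra_simps)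
  then have "pochhammer (w + 1) (2 * Suc n) * binomial_integral w z
      = (?W + 1) * (?W + 2) * (pochhammer (w + 1) (2 * n) * binomial_integral w z)"
    by (simp add: algebra_simps)
  also have "\<dots> = pochhammer (z + 1) n * pochhammer (w - z + 1) n * ((?W + 1) * (?W + 2) * binomial_integral ?W ?Z)"
    unfolding Suc by (simp add: algebra_simps)
  also have "(?W + 1) * (?W + 2) * binomial_integral ?W ?Z
      = (?Z + 1) * (?W - ?Z + 1) * binomial_integral (?W + 2) (?Z + 1)"
    by (rule binomial_integral_step) (use assms in \<open>simp add: add_strict_increasing2\<close>)
  also have "?W + 2 = w + of_nat (2 * Suc n)" by simp
  also have "?Z + 1 = z + of_nat (Suc n)" by simp
  also have "?W - ?Z + 1 = w - z + 1 + of_nat n" by simp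
  finally show ?case by (simp add: pochhammer_Suc algebra_simps)
qed auto

text \<open>Raising \<open>w\<close> by two for each unit of \<open>z\<close> multiplies the
  integrand by \<open>(1 + cis t)^2 * cis (-t) = 2 + 2 * cos t\<close>, a nonnegative real weight
  that peaks at \<open>t = 0\<close>.\<close>

lemma binomial_integral_shift_kernel:
  "binomial_integral (w + of_nat (2 * n)) (z + of_nat n)
    = (\<integral>t. ((1 + cis t) powr w * exp (-(\<i> * z * of_real t))) * of_real ((2 + 2 * cos t) ^ n) \<partial>circ)"
  unfolding binomial_integral_def
proof (intro Bochner_Integration.integral_cong refl)
  fix t assume "t \<in> space circ"
  then have nz: "1 + cis t \<noteq> 0" by (intro one_plus_cis_nz) simp
  have "(1 + cis t) powr (w + of_nat (2 * n)) = (1 + cis t) powr w * ((1 + cis t) ^ 2) ^ n"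
    unfolding power_mult[symmetric] powr_add using nz by (subst powr_nat') auto
  moreover have "exp (-(\<i> * (z + of_nat n) * of_real t)) = exp (-(\<i> * z * of_real t)) * cis (-t) ^ n"
    unfolding cis_conv_exp exp_of_nat_mult[symmetric] exp_add[symmetric]
    by (rule arg_cong[of _ _ exp]) (simp add: algebra_simps)
  moreover have "(1 + cis t) ^ 2 * cis (-t) = of_real (2 + 2 * cos t)"
  proof -
    have "(1 + cis t) ^ 2 * cis (-t) = cis (-t) + 2 * (cis t * cis (-t)) + cis t * (cis t * cis (-t))"
      by (simp add: power2_eq_square algebra_simps)
    also have "cis t * cis (-t) = 1" by (simp add: cis_mult)
    finally show ?thesis by (simp add: complex_eq_iff)
  qed
  then have "((1 + cis t) ^ 2) ^ n * cis (-t) ^ n = of_real ((2 + 2 * cos t) ^ n)"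
    by (metis power_mult_distrib of_real_power)
  ultimately show "(1 + cis t) powr (w + of_nat (2 * n)) * exp (-(\<i> * (z + of_nat n) * of_real t))
    = (1 + cis t) powr w * exp (-(\<i> * z * of_real t)) * of_real ((2 + 2 * cos t) ^ n)"
    by (simp add: mult_ac)
qed

section \<open>The powers of \<open>2 + 2 * cos t\<close> as an approximate identity\<close>

text \<open>The total mass comes from the same recurrence, taken at \<open>w = z = 0\<close>, where
  the integral is just the length of the interval.\<close>

lemma integral_two_plus_two_cos_power:
  "(\<integral>t. (2 + 2 * cos t) ^ n \<partial>circ) = 2 * pi * real ((2 * n) choose n)"
proof -
  have "binomial_integral 0 0 = (\<integral>t. 1 \<partial>circ)"
    unfolding binomial_integral_def
    by (intro Bochner_Integration.integral_cong refl) (simp add: one_plus_cis_nz)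
  also have "\<dots> = 2 * pi"
    by (rule integral_circ_eq) (use has_integral_const_real[of "1::complex" "-pi" pi] in
        \<open>auto intro!: integrable_circ_continuous simp: scaleR_conv_of_real\<close>)
  finally have "pochhammer (1::complex) (2 * n) * (2 * pi) = pochhammer 1 n * pochhammer 1 n * binomial_integral (of_nat (2 * n)) (of_nat n)"
    using binomial_integral_shift[of 0 n 0] by simp
  also have "binomial_integral (of_nat (2 * n)) (of_nat n) = (\<integral>t. of_real ((2 + 2 * cos t) ^ n) \<partial>circ)"
    unfolding binomial_integral_shift_kernel[of 0 n 0, unfolded add_0_left]
    by (intro Bochner_Integration.integral_cong refl) (simp add: one_plus_cis_nz)
  also have "\<dots> = of_real (\<integral>t. (2 + 2 * cos t) ^ n \<partial>circ)" by (rule integral_complex_of_real)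
  finally have "of_real (fact (2 * n) * (2 * pi)) = (of_real (fact n * fact n * (\<integral>t. (2 + 2 * cos t) ^ n \<partial>circ)) :: complex)"
    by (simp flip: pochhammer_fact)
  then have "fact (2 * n) * (2 * pi) = fact n * fact n * (\<integral>t. (2 + 2 * cos t) ^ n \<partial>circ)"
    by (simp only: of_real_eq_iff)
  moreover have "fact (2 * n) = fact n * fact n * real ((2 * n) choose n)"
    using binomial_fact[of n "2 * n", where 'a = real] by (simp add: mult_2)
  ultimately have "fact n * fact n * (\<integral>t. (2 + 2 * cos t) ^ n \<partial>circ)
      = fact n * fact n * (2 * pi * real ((2 * n) choose n))"
    by (simp only: mult_ac)
  then show ?thesis by (rule mult_left_cancel[THEN iffD1, rotated]) simp
qed

text \<open>The loss against \<open>4 ^ n\<close> is only a factor \<open>n\<close>, while away from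
  0 the weight is at most \<open>q ^ n\<close> for some \<open>q < 4\<close>.\<close>

lemma integral_two_plus_two_cos_power_lower:
  assumes "n > 0"
  shows "4 ^ n / real n \<le> (\<integral>t. (2 + 2 * cos t) ^ n \<partial>circ)"
proof -
  have "4 ^ n / real n \<le> 2 * pi * (4 ^ n / (2 * real n))"
    using pi_gt3 assms by (simp add: field_simps)
  also have "\<dots> \<le> 2 * pi * real ((2 * n) choose n)"
    using central_binomial_lower_bound[OF assms] by (intro mult_left_mono) auto
  finally show ?thesis by (simp add: integral_two_plus_two_cos_power)
qed

lemma two_plus_two_cos_nonneg: "0 \<le> 2 + 2 * cos t" for t :: real
  using cos_ge_minus_one[of t] by linarith

lemma integrable_two_plus_two_cos_power: "integrable circ (\<lambda>t. (2 + 2 * cos t) ^ n)"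
proof -
  have "integrable circ (\<lambda>t. complex_of_real ((2 + 2 * cos t) ^ n))"
    by (intro integrable_circ_continuous continuous_intros)
  then show ?thesis by (simp only: complex_of_real_integrable_eq)
qed

text \<open>Near 0 the oscillation of \<open>f\<close> is small. Away from 0 the weight divided by
  the total mass is at most \<open>n * (q / 4) ^ n\<close>, which tends to 0.\<close>

lemma approximate_identity:
  fixes f :: "real \<Rightarrow> complex"
  assumes f: "integrable circ f" and cont: "isCont f 0"
  defines "c \<equiv> (\<lambda>n. \<integral>t. (2 + 2 * cos t) ^ n \<partial>circ)"
  shows "(\<lambda>n. (\<integral>t. f t * of_real ((2 + 2 * cos t) ^ n) \<partial>circ) / of_real (c n)) \<longlonglongrightarrow> f 0"
proof (rule LIMSEQ_I)
  fix e :: real assume e: "e > 0"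
  have ic: "integrable circ (\<lambda>t. (2 + 2 * cos t) ^ n)" for n
    by (rule integrable_two_plus_two_cos_power)
  define g where "g = (\<lambda>t. f t - f 0)"
  have g: "integrable circ g"
    unfolding g_def using f by (intro Bochner_Integration.integrable_diff finite_measure.integrable_const finite_measure_circ)
  define L where "L = (\<integral>t. norm (g t) \<partial>circ)"
  obtain d where d: "d > 0" "\<And>t. \<bar>t\<bar> < d \<Longrightarrow> norm (g t) < e / 2"
  proof -
    from cont e obtain d where "d > 0" "\<forall>t. dist t 0 < d \<longrightarrow> dist (f t) (f 0) < e / 2"
      unfolding continuous_at_eps_delta by (metis half_gt_zero)
    then show ?thesis using that[of d] by (simp add: g_def dist_norm)
  qed
  \<comment> \<open>Positivity together with the cap at \<open>pi\<close> gives
    \<open>cos \<delta> < 1\<close>, hence \<open>q < 4\<close> below.\<close>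
  define \<delta> where "\<delta> = min d pi"
  have \<delta>: "\<delta> > 0" "\<delta> \<le> pi" using d by (auto simp: \<delta>_def)
  define q where "q = 2 + 2 * cos \<delta>"
  have q: "0 \<le> q" "q < 4"
  proof -
    show "0 \<le> q" unfolding q_def by (rule two_plus_two_cos_nonneg)
    have "cos \<delta> < cos 0" using \<delta> by (intro cos_monotone_0_pi) auto
    then show "q < 4" by (simp add: q_def)
  qed
  \<comment> \<open>Each summand on the right handles one range of \<open>t\<close>. The tail is
    charged to \<open>norm (g t)\<close> itself, since \<open>g\<close> is integrable but possibly
    unbounded.\<close>
  have bound: "norm (g t) * (2 + 2 * cos t) ^ n \<le> e / 2 * (2 + 2 * cos t) ^ n + q ^ n * norm (g t)"
    if t: "t \<in> {-pi<..<pi}" for t n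
  proof (cases "\<bar>t\<bar> < \<delta>")
    case True
    then have "norm (g t) * (2 + 2 * cos t) ^ n \<le> e / 2 * (2 + 2 * cos t) ^ n"
      using d(2)[of t] two_plus_two_cos_nonneg[of t] by (intro mult_right_mono) (auto simp: \<delta>_def)
    then show ?thesis using q by (simp add: add_increasing2)
  next
    case False
    then have "cos \<bar>t\<bar> \<le> cos \<delta>" using t \<delta> by (intro cos_monotone_0_pi_le) auto
    then have "2 + 2 * cos t \<le> q" by (simp add: q_def)
    then have "(2 + 2 * cos t) ^ n \<le> q ^ n" using two_plus_two_cos_nonneg by (intro power_mono)
    then have "norm (g t) * (2 + 2 * cos t) ^ n \<le> q ^ n * norm (g t)"
      by (subst mult.commute) (rule mult_right_mono, auto)
    then show ?thesis using e two_plus_two_cos_nonneg[of t] by (simp add: add_increasing)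
  qed
  have "(\<lambda>n. real n * (q / 4) ^ n * L) \<longlonglongrightarrow> 0 * L"
    using q by (intro tendsto_intros powser_times_n_limit_0) auto
  then have "eventually (\<lambda>n. real n * (q / 4) ^ n * L < e / 2) sequentially"
    using e by (intro order_tendstoD) auto
  then obtain N where N: "\<And>n. n \<ge> N \<Longrightarrow> real n * (q / 4) ^ n * L < e / 2"
    by (auto simp: eventually_sequentially)
  show "\<exists>no. \<forall>n\<ge>no. norm ((\<integral>t. f t * of_real ((2 + 2 * cos t) ^ n) \<partial>circ) / of_real (c n) - f 0) < e"
  proof (intro exI[of _ "Suc N"] allI impI)
    fix n assume n: "n \<ge> Suc N"
    have c: "4 ^ n / real n \<le> c n"
      unfolding c_def using n by (intro integral_two_plus_two_cos_power_lower) auto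
    have "0 < 4 ^ n / real n" using n by simp
    with c have cpos: "c n > 0" by linarith
    have if': "integrable circ (\<lambda>t. h t * of_real ((2 + 2 * cos t) ^ n))" if "integrable circ h" for h :: "real \<Rightarrow> complex"
      by (intro integrable_circ_mult_bounded that continuous_intros)
    have "(\<integral>t. f t * of_real ((2 + 2 * cos t) ^ n) \<partial>circ) - f 0 * c n
       = (\<integral>t. f t * of_real ((2 + 2 * cos t) ^ n) - f 0 * of_real ((2 + 2 * cos t) ^ n) \<partial>circ)"
      unfolding c_def using if'[OF f] ic
      by (subst Bochner_Integration.integral_diff) (auto simp flip: of_real_power simp del: of_real_power)
    also have "\<dots> = (\<integral>t. g t * of_real ((2 + 2 * cos t) ^ n) \<partial>circ)"
      by (simp add: g_def algebra_simps)
    also have "norm \<dots> \<le> (\<integral>t. norm (g t * of_real ((2 + 2 * cos t) ^ n)) \<partial>circ)"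
      by (rule integral_norm_bound)
    also have "\<dots> \<le> (\<integral>t. e / 2 * (2 + 2 * cos t) ^ n + q ^ n * norm (g t) \<partial>circ)"
    proof (rule integral_mono)
      show "integrable circ (\<lambda>t. norm (g t * of_real ((2 + 2 * cos t) ^ n)))"
        by (intro integrable_norm if' g)
      show "integrable circ (\<lambda>t. e / 2 * (2 + 2 * cos t) ^ n + q ^ n * norm (g t))"
        using ic g by auto
      fix t assume "t \<in> space circ"
      then show "norm (g t * of_real ((2 + 2 * cos t) ^ n)) \<le> e / 2 * (2 + 2 * cos t) ^ n + q ^ n * norm (g t)"
        using bound[of t n] two_plus_two_cos_nonneg[of t] by (simp only: norm_mult norm_of_real) simp
    qed
    also have "\<dots> = e / 2 * c n + q ^ n * L"
      unfolding c_def L_def using ic g by (subst Bochner_Integration.integral_add) auto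
    finally have "norm ((\<integral>t. f t * of_real ((2 + 2 * cos t) ^ n) \<partial>circ) - f 0 * c n) \<le> e / 2 * c n + q ^ n * L" .
    then have "norm ((\<integral>t. f t * of_real ((2 + 2 * cos t) ^ n) \<partial>circ) - f 0 * c n) / c n \<le> e / 2 + q ^ n * L / c n"
      using cpos by (simp add: field_simps)
    also have "q ^ n * L / c n \<le> q ^ n * L / (4 ^ n / real n)"
      using c q \<open>0 < 4 ^ n / real n\<close> by (intro divide_left_mono mult_nonneg_nonneg mult_pos_pos cpos) (auto simp: L_def)
    also have "\<dots> = real n * (q / 4) ^ n * L" by (simp add: power_divide)
    also have "\<dots> < e / 2" using n by (intro N) auto
    also have "norm ((\<integral>t. f t * of_real ((2 + 2 * cos t) ^ n) \<partial>circ) - f 0 * c n) / c n =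
       norm ((\<integral>t. f t * of_real ((2 + 2 * cos t) ^ n) \<partial>circ) / of_real (c n) - f 0)"
    proof -
      have "(\<integral>t. f t * of_real ((2 + 2 * cos t) ^ n) \<partial>circ) / of_real (c n) - f 0
         = ((\<integral>t. f t * of_real ((2 + 2 * cos t) ^ n) \<partial>circ) - f 0 * c n) / of_real (c n)"
        using cpos by (simp add: diff_divide_distrib)
      then show ?thesis using cpos by (simp add: norm_divide)
    qed
    finally show "norm ((\<integral>t. f t * of_real ((2 + 2 * cos t) ^ n) \<partial>circ) / of_real (c n) - f 0) < e" by simp
  qed
qed

section \<open>Passage to the limit in the recurrence: Cauchy's formula\<close>

text \<open>Gauss's limit for the reciprocal Gamma function with one factor fewer:
  \<open>rGamma_series (u + 1) n\<close> differs from the term here by the factor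
  \<open>1 + (u + 1) / n\<close>, which tends to 1.\<close>

lemma pochhammer_Suc_shift_limit:
  fixes u :: complex
  shows "(\<lambda>n. pochhammer (u + 1) n / (fact n * exp (u * of_real (ln (of_nat n))))) \<longlonglongrightarrow> rGamma (u + 1)"
proof -
  have "(\<lambda>n. rGamma_series (u + 1) n * (1 / (1 + (u + 1) / of_nat n))) \<longlonglongrightarrow> rGamma (u + 1) * (1 / (1 + 0))"
    by (intro tendsto_intros lim_const_over_n) auto
  moreover have "eventually (\<lambda>n. rGamma_series (u + 1) n * (1 / (1 + (u + 1) / of_nat n))
     = pochhammer (u + 1) n / (fact n * exp (u * of_real (ln (of_nat n))))) sequentially"
    \<comment> \<open>Beyond this threshold \<open>u + 1 + of_nat n\<close> is nonzero, so the extra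
      factor can be cancelled.\<close>
    using eventually_gt_at_top[of "nat \<lceil>norm (u + 1)\<rceil>"]
  proof eventually_elim
    case (elim n)
    then have *: "real n > norm (u + 1)" by linarith
    then have "real n > 0" using norm_ge_zero[of "u + 1"] by linarith
    then have "n > 0" by simp
    moreover have "u + 1 + of_nat n \<noteq> 0"
    proof
      assume "u + 1 + of_nat n = 0"
      then have "u + 1 = - of_nat n" by (simp add: eq_neg_iff_add_eq_0)
      then have "norm (u + 1) = real n" by (simp only: norm_minus_cancel norm_of_nat)
      with * show False by simp
    qed
    moreover have "exp ((u + 1) * of_real (ln (real n))) = exp (u * of_real (ln (real n))) * of_nat n"
      using \<open>n > 0\<close> by (simp add: distrib_right exp_add exp_of_real)
    moreover have "1 + (u + 1) / of_nat n = (u + 1 + of_nat n) / of_nat n"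
      using \<open>n > 0\<close> by (simp add: add_divide_distrib)
    moreover have "pochhammer (u + 1) (n + 1) = pochhammer (u + 1) n * (u + 1 + of_nat n)"
      by (simp add: pochhammer_Suc)
    ultimately show ?case
      unfolding rGamma_series_def by simp
  qed
  ultimately show ?thesis by (simp add: tendsto_cong)
qed

text \<open>Divide the shifted recurrence by the mass \<open>c n\<close> and let \<open>n\<close>
  grow. The approximate identity yields the value \<open>2 powr w\<close> of the integrand at 0, and
  the Pochhammer symbols turn into reciprocal Gamma values.\<close>

lemma binomial_integral_eq:
  assumes "Re w > -1"
  shows "binomial_integral w z = 2 * pi * gen_binomial w z"
proof -
  define P where "P = (\<lambda>u n. pochhammer (u + 1) n / (fact n * exp (u * of_real (ln (of_nat n)))) :: complex)"
  define c where "c = (\<lambda>n. \<integral>t. (2 + 2 * cos t) ^ n \<partial>circ)"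
  define A where "A = (\<lambda>n. binomial_integral (w + of_nat (2 * n)) (z + of_nat n) / of_real (c n))"
  have w: "w + 1 \<notin> \<int>\<^sub>\<le>\<^sub>0" using assms by (auto elim!: nonpos_Ints_cases simp: complex_eq_iff)
  have P: "P u \<longlonglongrightarrow> rGamma (u + 1)" for u
    unfolding P_def by (rule pochhammer_Suc_shift_limit)
  define f where "f = (\<lambda>t. (1 + cis t) powr w * exp (-(\<i> * z * of_real t)))"
  have "A \<longlonglongrightarrow> f 0"
    unfolding A_def binomial_integral_shift_kernel c_def f_def
  proof (rule approximate_identity)
    show "isCont (\<lambda>t. (1 + cis t) powr w * exp (-(\<i> * z * of_real t))) 0"
      unfolding isCont_def by (intro tendsto_intros tendsto_powr_complex) auto
  qed (rule integrable_binomial_integral[OF assms])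
  then have A: "A \<longlonglongrightarrow> 2 powr w" by (simp add: f_def)
  \<comment> \<open>For \<open>n > 0\<close> every term equals
    \<open>binomial_integral w z / (2 * pi)\<close>, so the limit is that constant. The limit
    \<open>rGamma (w + 1)\<close> of the denominator is nonzero because \<open>w + 1\<close> is not
    a pole of Gamma.\<close>
  have "(\<lambda>n. P z n * P (w - z) n / P w (2 * n) * (A n / 2 powr w)) \<longlonglongrightarrow>
      rGamma (z + 1) * rGamma (w - z + 1) / rGamma (w + 1) * (2 powr w / 2 powr w)"
    using w by (intro tendsto_intros P A filterlim_compose[OF P] filterlim_subseq)
      (auto simp: rGamma_eq_zero_iff strict_mono_def)
  moreover have "eventually (\<lambda>n. P z n * P (w - z) n / P w (2 * n) * (A n / 2 powr w)
      = binomial_integral w z / (2 * pi)) sequentially"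
    using eventually_gt_at_top[of 0]
  proof eventually_elim
    case (elim n)
    \<comment> \<open>The powers of \<open>n\<close> from the three \<open>P\<close> terms cancel;
      the surviving \<open>2 powr w\<close> cancels the division of \<open>A n\<close> by
      it.\<close>
    have ex: "exp (w * of_real (ln (real (2 * n)))) = 2 powr w * (exp (z * of_real (ln (real n))) * exp ((w - z) * of_real (ln (real n))))"
    proof -
      have "2 powr w = exp (w * of_real (ln 2))"
        using Ln_of_real[of 2] by (simp add: powr_def)
      moreover have "complex_of_real (ln (real (2 * n))) = of_real (ln 2) + of_real (ln (real n))"
        using elim by (simp add: ln_mult)
      ultimately show ?thesis
        by (simp only: exp_add[symmetric]) (simp only: algebra_simps, simp)
    qed
    have "0 < 4 ^ n / real n" using elim by simp
    then have "c n > 0" using integral_two_plus_two_cos_power_lower[OF elim] by (simp add: c_def)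
    have "pochhammer (w + 1) (2 * n) \<noteq> 0"
      using w by (auto simp: pochhammer_eq_0_iff)
    note p = this
    then have bi: "binomial_integral w z = pochhammer (z + 1) n * pochhammer (w - z + 1) n / pochhammer (w + 1) (2 * n)
        * (A n * of_real (c n))"
      using binomial_integral_shift[OF assms, of n z] \<open>c n > 0\<close>
      by (simp add: A_def nonzero_eq_divide_eq mult.commute)
    have "real ((2 * n) choose n) = fact (2 * n) / (fact n * fact n)"
      using binomial_fact[of n "2 * n", where 'a = real] by (simp add: mult_2)
    then have "c n = 2 * pi * (fact (2 * n) / (fact n * fact n))"
      by (simp only: c_def integral_two_plus_two_cos_power)
    then have cn: "complex_of_real (c n) = of_real (2 * pi) * (fact (2 * n) / (fact n * fact n))" by simp
    \<comment> \<open>The field identity behind the cancellation: \<open>f\<close> and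
      \<open>g\<close> stand for the factorials of \<open>n\<close> and \<open>2 * n\<close>,
      \<open>T\<close> for \<open>2 powr w\<close> and \<open>q\<close> for
      \<open>2 * pi\<close>.\<close>
    have alg: "a / (f * x) * (b / (f * y)) / (p / (g * (T * (x * y)))) * (a' / T)
        = a * b / p * (a' * (q * (g / (f * f)))) / q"
      if "f \<noteq> 0" "p \<noteq> 0" "g \<noteq> 0" "x \<noteq> 0" "y \<noteq> 0" "T \<noteq> 0" "q \<noteq> 0" for a b f x y p g T a' q :: complex
      using that by (simp add: field_simps)
    show ?case unfolding P_def bi cn ex by (rule alg) (use p in auto)
  qed
  ultimately have "(\<lambda>n::nat. binomial_integral w z / (2 * pi)) \<longlonglongrightarrow>
      rGamma (z + 1) * rGamma (w - z + 1) / rGamma (w + 1) * (2 powr w / 2 powr w)"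
    by (rule Lim_transform_eventually)
  then have "binomial_integral w z / (2 * pi) = rGamma (z + 1) * rGamma (w - z + 1) / rGamma (w + 1)"
    by (simp add: LIMSEQ_const_iff)
  also have "\<dots> = gen_binomial w z"
    by (simp add: gen_binomial_def rGamma_inverse_Gamma[of "w + 1"] divide_inverse mult_ac)
  finally show ?thesis by (simp add: field_simps)
qed

section \<open>The Fourier transform of 1/(x^2+\<alpha>^2)\<close>

lemma square_plus_square_factor: "z\<^sup>2 + \<alpha>\<^sup>2 = (z - \<i> * \<alpha>) * (z + \<i> * \<alpha>)" for z \<alpha> :: complex
  by (simp add: power2_eq_square algebra_simps)

text \<open>Both linear factors have imaginary part of modulus \<open>Re \<alpha>\<close>, which
  gives the first bound, useful for bounded \<open>x\<close>. The reverse triangle inequality gives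
  the second, which provides the decay.\<close>

lemma norm_square_plus_square_ge:
  assumes "Re \<alpha> > 0"
  shows "(Re \<alpha>)\<^sup>2 \<le> norm ((complex_of_real x)\<^sup>2 + \<alpha>\<^sup>2)"
    and "x\<^sup>2 - (norm \<alpha>)\<^sup>2 \<le> norm ((complex_of_real x)\<^sup>2 + \<alpha>\<^sup>2)"
proof -
  have "Re \<alpha> \<le> norm (of_real x - \<i> * \<alpha>)" "Re \<alpha> \<le> norm (of_real x + \<i> * \<alpha>)"
    using abs_Im_le_cmod[of "of_real x - \<i> * \<alpha>"] abs_Im_le_cmod[of "of_real x + \<i> * \<alpha>"] by auto
  then show "(Re \<alpha>)\<^sup>2 \<le> norm ((complex_of_real x)\<^sup>2 + \<alpha>\<^sup>2)"
    using assms unfolding square_plus_square_factor norm_mult power2_eq_square[of "Re \<alpha>"] by (intro mult_mono) auto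
  have "norm ((complex_of_real x)\<^sup>2) - norm (- \<alpha>\<^sup>2) \<le> norm ((complex_of_real x)\<^sup>2 - - \<alpha>\<^sup>2)"
    by (rule norm_triangle_ineq2)
  then show "x\<^sup>2 - (norm \<alpha>)\<^sup>2 \<le> norm ((complex_of_real x)\<^sup>2 + \<alpha>\<^sup>2)"
    by (simp add: norm_power)
qed

lemma norm_inverse_square_plus_square_le:
  assumes "Re \<alpha> > 0"
  obtains C where "\<And>x. norm (1 / ((complex_of_real x)\<^sup>2 + \<alpha>\<^sup>2)) \<le> C * inverse (1 + x\<^sup>2)" "C > 0"
proof -
  \<comment> \<open>From 1 + x^2 = (1 + |\<alpha>|^2) + (x^2 - |\<alpha>|^2): the first lower bound
    absorbs the first bracket, the second lower bound the other.\<close>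
  define C where "C = 1 + (1 + (norm \<alpha>)\<^sup>2) / (Re \<alpha>)\<^sup>2"
  have C: "C > 0" unfolding C_def by (intro add_pos_nonneg) auto
  have "norm (1 / ((complex_of_real x)\<^sup>2 + \<alpha>\<^sup>2)) \<le> C * inverse (1 + x\<^sup>2)" for x
  proof -
    define N where "N = norm ((complex_of_real x)\<^sup>2 + \<alpha>\<^sup>2)"
    have N: "(Re \<alpha>)\<^sup>2 \<le> N" "x\<^sup>2 - (norm \<alpha>)\<^sup>2 \<le> N"
      using norm_square_plus_square_ge[OF assms, of x] by (auto simp: N_def)
    have a: "(Re \<alpha>)\<^sup>2 > 0" using assms by simp
    have "1 + (norm \<alpha>)\<^sup>2 = (1 + (norm \<alpha>)\<^sup>2) / (Re \<alpha>)\<^sup>2 * (Re \<alpha>)\<^sup>2" using a by simp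
    also have "\<dots> \<le> (1 + (norm \<alpha>)\<^sup>2) / (Re \<alpha>)\<^sup>2 * N"
      using N by (intro mult_left_mono) auto
    finally have "1 + x\<^sup>2 \<le> C * N" using N by (simp add: C_def distrib_right)
    moreover have "N > 0" using a N by linarith
    moreover have "1 + x\<^sup>2 > 0" by (simp add: add_pos_nonneg)
    ultimately show ?thesis by (simp add: norm_divide flip: N_def) (simp add: field_simps)
  qed
  with C that show ?thesis by blast
qed

lemma integrable_inverse_one_plus_square: "integrable lborel (\<lambda>x::real. inverse (1 + x\<^sup>2))"
  using integrable_inverse_1_plus_square by (simp add: set_integrable_def einterval_def)

lemma integrable_bounded_mult_inverse_square_plus_square:
  fixes f :: "real \<Rightarrow> complex"
  assumes "Re \<alpha> > 0" "f \<in> borel_measurable lborel" "\<And>x. norm (f x) \<le> B"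
  shows "integrable lborel (\<lambda>x. f x * (1 / ((of_real x)\<^sup>2 + \<alpha>\<^sup>2)))"
proof -
  obtain C where C: "\<And>x. norm (1 / ((complex_of_real x)\<^sup>2 + \<alpha>\<^sup>2)) \<le> C * inverse (1 + x\<^sup>2)" "C > 0"
    using norm_inverse_square_plus_square_le[OF assms(1)] by blast
  show ?thesis
  proof (rule Bochner_Integration.integrable_bound)
    show "integrable lborel (\<lambda>x::real. B * (C * inverse (1 + x\<^sup>2)))"
      using integrable_inverse_one_plus_square by simp
    show "(\<lambda>x. f x * (1 / ((of_real x)\<^sup>2 + \<alpha>\<^sup>2))) \<in> borel_measurable lborel"
      using assms(2) by measurable
    have "norm (f x * (1 / ((of_real x)\<^sup>2 + \<alpha>\<^sup>2))) \<le> B * (C * inverse (1 + x\<^sup>2))" for x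
      unfolding norm_mult using order_trans[OF norm_ge_zero assms(3)] by (intro mult_mono assms C) auto
    then show "AE x in lborel. norm (f x * (1 / ((of_real x)\<^sup>2 + \<alpha>\<^sup>2))) \<le> norm (B * (C * inverse (1 + x\<^sup>2)))"
      by (intro AE_I2) (simp only: real_norm_def order_trans[OF _ abs_ge_self])
  qed
qed

text \<open>Dominated convergence with majorant \<open>norm (f x)\<close>. With integrability known
  beforehand, the limit over symmetric intervals is the full integral.\<close>

lemma integral_lborel_symmetric_limit:
  fixes f :: "real \<Rightarrow> complex"
  assumes "integrable lborel f" "\<And>R. (f has_integral I R) {- real R..real R}" "I \<longlonglongrightarrow> J"
  shows "integral\<^sup>L lborel f = J"
proof -
  have "(\<lambda>R. \<integral>x. indicator {- real R..real R} x *\<^sub>R f x \<partial>lborel) \<longlonglongrightarrow> integral\<^sup>L lborel f"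
  proof (rule integral_dominated_convergence[where w = "\<lambda>x. norm (f x)"])
    show "AE x in lborel. (\<lambda>R. indicator {- real R..real R} x *\<^sub>R f x) \<longlonglongrightarrow> f x"
    proof (rule AE_I2)
      fix x :: real
      have "eventually (\<lambda>R. indicator {- real R..real R} x *\<^sub>R f x = f x) sequentially"
        using eventually_ge_at_top[of "nat \<lceil>\<bar>x\<bar>\<rceil>"]
      proof eventually_elim
        case (elim R)
        then have "\<bar>x\<bar> \<le> real R" by linarith
        then show ?case by (auto simp: indicator_def)
      qed
      then show "(\<lambda>R. indicator {- real R..real R} x *\<^sub>R f x) \<longlonglongrightarrow> f x"
        by (rule tendsto_eventually)
    qed
  qed (use assms(1) in \<open>auto simp: indicator_def\<close>)
  moreover have "(\<integral>x. indicator {- real R..real R} x *\<^sub>R f x \<partial>lborel) = I R" for R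
  proof -
    have "set_integrable lborel {- real R..real R} f"
      using assms(1) unfolding set_integrable_def by (intro integrable_mult_indicator) auto
    from set_borel_integral_eq_integral(2)[OF this] show ?thesis
      using assms(2)[of R] by (simp add: set_lebesgue_integral_def integral_unique)
  qed
  ultimately show ?thesis using assms(3) LIMSEQ_unique by auto
qed

lemma Ln_one_plus_over_nat_limit: "(\<lambda>n. Ln (1 + c / of_nat n)) \<longlonglongrightarrow> 0"
proof -
  have "(\<lambda>n. Ln (1 + c / of_nat n)) \<longlonglongrightarrow> Ln (1 + 0)"
    by (intro tendsto_intros lim_const_over_n) auto
  then show ?thesis by simp
qed

text \<open>Partial fractions give a logarithmic primitive. For real \<open>x\<close> the points
  \<open>x - \<i> * \<alpha>\<close> and \<open>x + \<i> * \<alpha>\<close> stay in the open lower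
  and upper half-plane, so neither logarithm meets its branch cut.\<close>

lemma integral_inverse_square_plus_square:
  assumes "Re \<alpha> > 0"
  shows "(\<integral>x. 1 / ((of_real x)\<^sup>2 + \<alpha>\<^sup>2) \<partial>lborel) = of_real pi / \<alpha>"
proof (rule integral_lborel_symmetric_limit)
  have \<alpha>: "\<alpha> \<noteq> 0" using assms by auto
  show "integrable lborel (\<lambda>x. 1 / ((complex_of_real x)\<^sup>2 + \<alpha>\<^sup>2))"
    using integrable_bounded_mult_inverse_square_plus_square[OF assms, of "\<lambda>_. 1" 1] by simp
  define G where "G = (\<lambda>z. (Ln (z - \<i> * \<alpha>) - Ln (z + \<i> * \<alpha>)) / (2 * \<i> * \<alpha>))"
  show "((\<lambda>x. 1 / ((complex_of_real x)\<^sup>2 + \<alpha>\<^sup>2)) has_integral G (real R) - G (- real R)) {- real R..real R}" for R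
  proof -
    have "((\<lambda>x. 1 / ((complex_of_real x)\<^sup>2 + \<alpha>\<^sup>2)) has_integral G (of_real (real R)) - G (of_real (- real R))) {- real R..real R}"
    proof (rule fundamental_theorem_of_calculus)
      fix x :: real
      have nz: "of_real x - \<i> * \<alpha> \<noteq> 0" "of_real x + \<i> * \<alpha> \<noteq> 0"
        using assms by (auto simp: complex_eq_iff)
      have "(G has_field_derivative (1 / (of_real x - \<i> * \<alpha>) - 1 / (of_real x + \<i> * \<alpha>)) / (2 * \<i> * \<alpha>)) (at (of_real x))"
        unfolding G_def using assms \<alpha> nz
        by (auto intro!: derivative_eq_intros simp: complex_nonpos_Reals_iff divide_simps)
      also have "(1 / (of_real x - \<i> * \<alpha>) - 1 / (of_real x + \<i> * \<alpha>)) / (2 * \<i> * \<alpha>) = 1 / ((complex_of_real x)\<^sup>2 + \<alpha>\<^sup>2)"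
        unfolding square_plus_square_factor using nz \<alpha> by (simp add: divide_simps)
      finally show "((\<lambda>x. G (of_real x)) has_vector_derivative 1 / ((complex_of_real x)\<^sup>2 + \<alpha>\<^sup>2)) (at x within {- real R..real R})"
        by (rule has_vector_derivative_real_field)
    qed auto
    then show ?thesis by simp
  qed
  have "(\<lambda>R. of_real pi / \<alpha> + (Ln (1 + (- \<i> * \<alpha>) / of_nat R) - Ln (1 + (\<i> * \<alpha>) / of_nat R)) / (\<i> * \<alpha>)) \<longlonglongrightarrow> of_real pi / \<alpha> + (0 - 0) / (\<i> * \<alpha>)"
    using \<alpha> by (intro tendsto_intros Ln_one_plus_over_nat_limit) auto
  moreover have "eventually (\<lambda>R. of_real pi / \<alpha> + (Ln (1 + (- \<i> * \<alpha>) / of_nat R) - Ln (1 + (\<i> * \<alpha>) / of_nat R)) / (\<i> * \<alpha>)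
     = G (real R) - G (- real R)) sequentially"
    using eventually_gt_at_top[of 0]
  proof eventually_elim
    case (elim R)
    have *: "Ln (of_nat R + c) = of_real (ln (real R)) + Ln (1 + c / of_nat R)" if "Im c \<noteq> 0" for c
    proof -
      have "1 + c / of_nat R \<noteq> 0" using that elim by (auto simp: complex_eq_iff Im_divide_of_nat)
      then have "Ln (of_real (real R) * (1 + c / of_nat R)) = of_real (ln (real R)) + Ln (1 + c / of_nat R)"
        using elim by (subst Ln_times_of_real) (auto simp: Ln_of_real)
      then show ?thesis using elim by (simp add: distrib_left)
    qed
    \<comment> \<open>The half-plane of the argument decides the sign of \<open>\<i> * pi\<close>.
      These two jumps produce the value of the integral; the real logarithms of \<open>R\<close>
      cancel.\<close>
    have 1: "Ln (- of_nat R - \<i> * \<alpha>) = Ln (of_nat R + \<i> * \<alpha>) - \<i> * pi"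
      using assms Ln_minus[of "of_nat R + \<i> * \<alpha>"] by (auto simp: complex_eq_iff)
    have 2: "Ln (\<i> * \<alpha> - of_nat R) = Ln (of_nat R - \<i> * \<alpha>) + \<i> * pi"
      using assms Ln_minus[of "of_nat R - \<i> * \<alpha>"] by (auto simp: complex_eq_iff)
    have 3: "Ln (of_nat R + \<i> * \<alpha>) = of_real (ln (real R)) + Ln (1 + (\<i> * \<alpha>) / of_nat R)"
      using assms by (intro *) auto
    have 4: "Ln (of_nat R - \<i> * \<alpha>) = of_real (ln (real R)) + Ln (1 + (- \<i> * \<alpha>) / of_nat R)"
      using assms *[of "- \<i> * \<alpha>"] by auto
    show ?case using \<alpha> unfolding G_def
      by (simp add: 1 2) (simp add: 3 4 field_simps)
  qed
  ultimately show "(\<lambda>R. G (real R) - G (- real R)) \<longlonglongrightarrow> of_real pi / \<alpha>"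
    by (simp add: tendsto_cong)
qed

text \<open>Cauchy's theorem on half-discs shows that the line integral of \<open>g\<close>, the
  integrand minus \<open>E / (x^2 + \<alpha>^2)\<close>, vanishes. The subtracted part is known from
  the preceding lemma.\<close>

lemma Fourier_inverse_square_plus_square_nonneg:
  assumes "Re \<alpha> > 0" "s \<ge> 0"
  shows "(\<integral>x. exp (\<i> * of_real s * of_real x) * (1 / ((of_real x)\<^sup>2 + \<alpha>\<^sup>2)) \<partial>lborel) = of_real pi / \<alpha> * exp (-(\<alpha> * of_real s))"
proof -
  have \<alpha>: "\<alpha> \<noteq> 0" using assms by auto
  define E where "E = exp (-(\<alpha> * of_real s))"
  define h where "h = (\<lambda>z. exp (\<i> * of_real s * z))"
  \<comment> \<open>Subtracting the value at \<open>\<i> * \<alpha>\<close> removes the only pole in the upper half-plane, so no residue arises.\<close>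
  define q where "q = (\<lambda>z. if z = \<i> * \<alpha> then deriv h (\<i> * \<alpha>) else (h z - h (\<i> * \<alpha>)) / (z - \<i> * \<alpha>))"
  \<comment> \<open>The remaining singularity \<open>- \<i> * \<alpha>\<close> has imaginary part
    \<open>- Re \<alpha>\<close>, so it lies outside the open half-plane used below.\<close>
  define g where "g = (\<lambda>z. q z / (z + \<i> * \<alpha>))"
  have hE: "h (\<i> * \<alpha>) = E" unfolding h_def E_def by (rule arg_cong[of _ _ exp]) (simp add: algebra_simps)
  have "q holomorphic_on UNIV"
    unfolding q_def by (rule pole_lemma) (auto simp: h_def intro!: holomorphic_intros)
  then have q: "q holomorphic_on {z. Im z > - Re \<alpha>}" by (rule holomorphic_on_subset) auto
  have g: "g holomorphic_on {z. Im z > - Re \<alpha>}"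
    unfolding g_def by (intro holomorphic_intros q) (auto simp: complex_eq_iff)
  have geq: "g z = (h z - E) / (z\<^sup>2 + \<alpha>\<^sup>2)" if "z \<noteq> \<i> * \<alpha>" for z
    using that by (simp add: g_def q_def hE square_plus_square_factor)
  have int: "integrable lborel (\<lambda>x. f x * (1 / ((of_real x)\<^sup>2 + \<alpha>\<^sup>2)))"
    if "f \<in> borel_measurable lborel" "\<And>x. norm (f x) \<le> B" for f :: "real \<Rightarrow> complex" and B
    using that by (rule integrable_bounded_mult_inverse_square_plus_square[OF assms(1)])
  have i1: "integrable lborel (\<lambda>x. h (of_real x) * (1 / ((of_real x)\<^sup>2 + \<alpha>\<^sup>2)))"
    by (rule int[where B = 1]) (auto simp: h_def)
  have i2: "integrable lborel (\<lambda>x. E * (1 / ((of_real x)\<^sup>2 + \<alpha>\<^sup>2)))"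
    by (rule int[where B = "norm E"]) auto
  have gx: "g (of_real x) = h (of_real x) * (1 / ((of_real x)\<^sup>2 + \<alpha>\<^sup>2)) - E * (1 / ((of_real x)\<^sup>2 + \<alpha>\<^sup>2))" for x :: real
  proof -
    have "complex_of_real x \<noteq> \<i> * \<alpha>" using assms by (auto simp: complex_eq_iff)
    then show ?thesis by (simp add: geq diff_divide_distrib)
  qed
  define I where "I = (\<lambda>R. integral {- real R..real R} (\<lambda>x. g (of_real x)))"
  have "(\<integral>x. g (of_real x) \<partial>lborel) = 0"
  proof (rule integral_lborel_symmetric_limit)
    show "integrable lborel (\<lambda>x. g (complex_of_real x))"
      unfolding gx using i1 i2 by (rule Bochner_Integration.integrable_diff)
    show "((\<lambda>x. g (complex_of_real x)) has_integral I R) {- real R..real R}" for R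
    proof -
      have cont: "continuous_on (of_real ` {- real R..real R}) g"
        using holomorphic_on_imp_continuous_on[OF g] by (rule continuous_on_subset) (use assms in auto)
      have "(\<lambda>x. g (complex_of_real x)) integrable_on {- real R..real R}"
        by (rule integrable_continuous_real, rule continuous_on_compose2[OF cont _ subset_refl]) (intro continuous_intros)
      then show ?thesis unfolding I_def by (rule integrable_integral)
    qed
    \<comment> \<open>Length \<open>R * pi\<close> of the semicircle times a bound for
      \<open>g\<close> on it; the denominator is positive once \<open>R\<close> exceeds
      \<open>norm \<alpha>\<close>.\<close>
    define N where "N = (\<lambda>R. (1 + norm E) / ((real R)\<^sup>2 - (norm \<alpha>)\<^sup>2) * real R * pi)"
    have "eventually (\<lambda>R. norm (I R) \<le> N R) sequentially"
      using eventually_gt_at_top[of "nat \<lceil>norm \<alpha>\<rceil>"]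
    proof eventually_elim
      case (elim R)
      then have R: "real R > norm \<alpha>" by linarith
      then have R0: "real R > 0" using norm_ge_zero[of \<alpha>] by linarith
      define arc where "arc = part_circlepath 0 (real R) 0 pi"
      define seg where "seg = linepath (complex_of_real (- real R)) (of_real (real R))"
      have arc_ends: "pathstart arc = of_real (real R)" "pathfinish arc = of_real (- real R)"
        by (auto simp: arc_def exp_pi_i')
      have arc_in: "Im z \<ge> 0 \<and> norm z = real R" if "z \<in> path_image arc" for z
        using that R0 unfolding arc_def
        by (auto simp: path_image_part_circlepath Im_exp norm_mult intro!: mult_nonneg_nonneg sin_ge_zero)
      have arc_sub: "path_image arc \<subseteq> {z. Im z > - Re \<alpha>}" using arc_in assms by force
      have seg_sub: "path_image seg \<subseteq> {z. Im z > - Re \<alpha>}"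
        unfolding seg_def path_image_linepath
        using assms by (intro closed_segment_subset) (auto simp: convex_halfspace_Im_gt)
      have "(g has_contour_integral 0) (seg +++ arc)"
        using arc_ends arc_sub seg_sub
        by (intro Cauchy_theorem_convex_simple[OF g])
           (auto simp: convex_halfspace_Im_gt seg_def path_image_join arc_def intro!: valid_path_join)
      moreover have ci: "g contour_integrable_on seg" "g contour_integrable_on arc"
        using arc_sub seg_sub g open_halfspace_Im_gt
        by (auto intro!: contour_integrable_holomorphic_simple simp: seg_def arc_def)
      ultimately have "contour_integral seg g + contour_integral arc g = 0"
        using arc_ends by (metis contour_integral_join contour_integral_unique valid_path_linepath valid_path_part_circlepath seg_def arc_def)
      moreover have "contour_integral seg g = I R"
        unfolding I_def seg_def using R0 by (subst contour_integral_linepath_Reals_eq) auto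
      ultimately have "norm (I R) = norm (contour_integral arc g)"
        by (metis add_eq_0_iff norm_minus_cancel)
      also have "\<dots> \<le> (1 + norm E) / ((real R)\<^sup>2 - (norm \<alpha>)\<^sup>2) * real R * \<bar>pi - 0\<bar>"
        unfolding arc_def
      proof (rule contour_integral_bound_part_circlepath)
        show "g contour_integrable_on part_circlepath 0 (real R) 0 pi" using ci by (simp add: arc_def)
        have d: "(real R)\<^sup>2 - (norm \<alpha>)\<^sup>2 > 0" using R by (simp add: power_strict_mono)
        then show "0 \<le> (1 + norm E) / ((real R)\<^sup>2 - (norm \<alpha>)\<^sup>2)" by (intro divide_nonneg_pos) auto
        fix z assume "z \<in> path_image (part_circlepath 0 (real R) 0 pi)"
        then have z: "Im z \<ge> 0" "norm z = real R" using arc_in by (auto simp: arc_def)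
        then have "z \<noteq> \<i> * \<alpha>" using R by (auto simp: norm_mult)
        then have "norm (g z) = norm (h z - E) / norm (z\<^sup>2 + \<alpha>\<^sup>2)" by (simp add: geq norm_divide)
        also have "norm (h z - E) \<le> norm (h z) + norm E" by (rule norm_triangle_ineq4)
        \<comment> \<open>Here \<open>s \<ge> 0\<close> enters: the exponential is bounded by 1 on
          the closed upper half-plane.\<close>
        also have "norm (h z) \<le> 1" using z assms by (simp add: h_def norm_exp_eq_Re)
        also have "(1 + norm E) / norm (z\<^sup>2 + \<alpha>\<^sup>2) \<le> (1 + norm E) / ((real R)\<^sup>2 - (norm \<alpha>)\<^sup>2)"
        proof (rule divide_left_mono)
          show "(real R)\<^sup>2 - (norm \<alpha>)\<^sup>2 \<le> norm (z\<^sup>2 + \<alpha>\<^sup>2)"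
            using norm_triangle_ineq2[of "z\<^sup>2" "- \<alpha>\<^sup>2"] z by (simp add: norm_power)
          with d show "0 < norm (z\<^sup>2 + \<alpha>\<^sup>2) * ((real R)\<^sup>2 - (norm \<alpha>)\<^sup>2)" by (intro mult_pos_pos) linarith+
        qed auto
        finally show "norm (g z) \<le> (1 + norm E) / ((real R)\<^sup>2 - (norm \<alpha>)\<^sup>2)"
          by (simp add: divide_right_mono)
      qed (use R0 in auto)
      finally show "norm (I R) \<le> N R" by (simp add: N_def)
    qed
    moreover have "N \<longlonglongrightarrow> 0"
      unfolding N_def by real_asymp
    ultimately show "I \<longlonglongrightarrow> 0" by (rule Lim_null_comparison)
  qed
  then have "(\<integral>x. h (of_real x) * (1 / ((of_real x)\<^sup>2 + \<alpha>\<^sup>2)) \<partial>lborel) = (\<integral>x. E * (1 / ((of_real x)\<^sup>2 + \<alpha>\<^sup>2)) \<partial>lborel)"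
    unfolding gx Bochner_Integration.integral_diff[OF i1 i2] by simp
  also have "\<dots> = E * (of_real pi / \<alpha>)"
    by (subst integral_mult_right_zero) (simp only: integral_inverse_square_plus_square[OF assms(1)])
  finally show ?thesis by (simp add: h_def E_def)
qed

text \<open>Negative \<open>t\<close> is the preceding case with \<open>s = -t\<close>. For the
  others the substitution of \<open>-x\<close> for \<open>x\<close> works, since the denominator is
  even.\<close>

lemma Fourier_inverse_square_plus_square:
  assumes "Re \<alpha> > 0"
  shows "(\<integral>x. exp (-(\<i> * of_real x * of_real t)) * (1 / ((of_real x)\<^sup>2 + \<alpha>\<^sup>2)) \<partial>lborel) = of_real pi / \<alpha> * exp (-(\<alpha> * of_real \<bar>t\<bar>))"
proof (cases "t \<ge> 0")
  case False
  then show ?thesis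
    using Fourier_inverse_square_plus_square_nonneg[OF assms, of "-t"] by (simp add: mult_ac)
next
  case True
  have "(\<integral>x. exp (-(\<i> * of_real x * of_real t)) * (1 / ((of_real x)\<^sup>2 + \<alpha>\<^sup>2)) \<partial>lborel)
     = (\<integral>x. exp (\<i> * of_real t * of_real x) * (1 / ((of_real x)\<^sup>2 + \<alpha>\<^sup>2)) \<partial>lborel)"
    by (subst lborel_integral_real_affine[where c = "-1" and t = 0]) (auto simp: mult_ac)
  then show ?thesis
    using Fourier_inverse_square_plus_square_nonneg[OF assms True] True by simp
qed

section \<open>The sum and the integral as integrals over one period\<close>

text \<open>
  The function \<open>C\<close> above, equal to \<open>(\<pi>/\<alpha>) cosh (\<alpha>(\<pi> - \<bar>t\<bar>)) / sinh (\<pi>\<alpha>)\<close>, written as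
  the Fourier transform of \<open>1/(x\<^sup>2+\<alpha>\<^sup>2)\<close> plus the difference.
\<close>

definition resolvent_kernel :: "complex \<Rightarrow> real \<Rightarrow> complex" where
  "resolvent_kernel \<alpha> t = of_real pi / \<alpha> * (exp (-(\<alpha> * of_real \<bar>t\<bar>))
     + (exp (\<alpha> * of_real t) + exp (-(\<alpha> * of_real t))) / (exp (2 * of_real pi * \<alpha>) - 1))"

lemma continuous_on_resolvent_kernel:
  "continuous_on A (resolvent_kernel \<alpha>)"
  unfolding resolvent_kernel_def divide_inverse
  by (intro continuous_on_const continuous_on_mult continuous_on_add continuous_on_exp continuous_on_minus
      continuous_on_of_real continuous_on_rabs continuous_on_id)

lemma has_integral_exp:
  fixes \<beta> :: complex
  assumes "\<beta> \<noteq> 0" "a \<le> b"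
  shows "((\<lambda>t. exp (\<beta> * of_real t)) has_integral (exp (\<beta> * of_real b) - exp (\<beta> * of_real a)) / \<beta>) {a..b}"
proof -
  have "((\<lambda>t. exp (\<beta> * of_real t)) has_integral exp (\<beta> * of_real b) / \<beta> - exp (\<beta> * of_real a) / \<beta>) {a..b}"
  proof (rule fundamental_theorem_of_calculus[OF assms(2)])
    fix x :: real
    have "((\<lambda>z. exp (\<beta> * z) / \<beta>) has_field_derivative exp (\<beta> * of_real x)) (at (of_real x))"
      using assms by (auto intro!: derivative_eq_intros)
    then show "((\<lambda>t. exp (\<beta> * of_real t) / \<beta>) has_vector_derivative exp (\<beta> * of_real x)) (at x within {a..b})"
      by (rule has_vector_derivative_real_field)
  qed
  then show ?thesis by (simp add: diff_divide_distrib)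
qed

lemma exp_2pi_nz:
  assumes "Re \<alpha> > 0"
  shows "exp (2 * of_real pi * \<alpha>) \<noteq> 1"
proof
  assume "exp (2 * of_real pi * \<alpha>) = 1"
  then have "norm (exp (2 * of_real pi * \<alpha>)) = 1" by simp
  then show False using assms by (simp add: norm_exp_eq_Re)
qed

text \<open>All integrands are exponentials with rates \<open>u\<close> and \<open>v\<close>. The
  quotient by \<open>q\<close> in the kernel is exactly what cancels the contributions of the
  endpoints, leaving only the kink at 0, which gives \<open>1 / v - 1 / u\<close>.\<close>

lemma resolvent_kernel_Fourier_coefficient:
  assumes "Re \<alpha> > 0"
  shows "(\<integral>t. cis t ^ k * resolvent_kernel \<alpha> t \<partial>circ) = 2 * of_real pi * (1 / ((of_nat k)\<^sup>2 + \<alpha>\<^sup>2))"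
proof (rule integral_circ_eq)
  have \<alpha>: "\<alpha> \<noteq> 0" using assms by auto
  show "integrable circ (\<lambda>t. cis t ^ k * resolvent_kernel \<alpha> t)"
    by (intro integrable_circ_continuous continuous_intros continuous_on_resolvent_kernel)
  define q where "q = exp (2 * of_real pi * \<alpha>) - 1"
  have q: "q \<noteq> 0" using exp_2pi_nz[OF assms] by (simp add: q_def)
  define u where "u = \<i> * of_nat k - \<alpha>"
  define v where "v = \<i> * of_nat k + \<alpha>"
  have uv: "u \<noteq> 0" "v \<noteq> 0" using assms by (auto simp: u_def v_def complex_eq_iff)
  define \<epsilon> where "\<epsilon> = exp (\<i> * of_nat k * of_real pi)"
  have \<epsilon>2: "exp (- (\<i> * of_nat k * of_real pi)) = \<epsilon>"
  proof -
    have "exp (\<i> * of_nat k * of_real pi) = (-1) ^ k" "exp (- (\<i> * of_nat k * of_real pi)) = (-1) ^ k"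
      using exp_of_nat_mult[of k "\<i> * of_real pi"] exp_of_nat_mult[of k "- (\<i> * of_real pi)"]
      by (simp_all add: mult_ac exp_minus)
    then show ?thesis by (simp add: \<epsilon>_def)
  qed
  define X where "X = exp (\<alpha> * of_real pi)"
  have X: "X \<noteq> 0" "exp (- (\<alpha> * of_real pi)) = 1 / X" by (auto simp: X_def exp_minus divide_inverse)
  have qX: "q = X\<^sup>2 - 1" unfolding q_def X_def by (simp add: mult_ac flip: exp_of_nat_mult[of 2, simplified] exp_double)
  have ex: "exp (u * of_real pi) = \<epsilon> / X" "exp (v * of_real pi) = \<epsilon> * X"
     "exp (u * of_real (-pi)) = \<epsilon> * X" "exp (v * of_real (-pi)) = \<epsilon> / X"
  proof -
    have "exp (u * of_real pi) = exp (\<i> * of_nat k * of_real pi) * exp (- (\<alpha> * of_real pi))"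
      "exp (v * of_real pi) = exp (\<i> * of_nat k * of_real pi) * exp (\<alpha> * of_real pi)"
      "exp (u * of_real (-pi)) = exp (- (\<i> * of_nat k * of_real pi)) * exp (\<alpha> * of_real pi)"
      "exp (v * of_real (-pi)) = exp (- (\<i> * of_nat k * of_real pi)) * exp (- (\<alpha> * of_real pi))"
      unfolding u_def v_def exp_add[symmetric] by (rule arg_cong[of _ _ exp], simp add: algebra_simps)+
    then show "exp (u * of_real pi) = \<epsilon> / X" "exp (v * of_real pi) = \<epsilon> * X"
     "exp (u * of_real (-pi)) = \<epsilon> * X" "exp (v * of_real (-pi)) = \<epsilon> / X"
      unfolding X(2) \<epsilon>2 \<epsilon>_def[symmetric] X_def[symmetric] by simp_all
  qed
  have cis: "cis t ^ k = exp (\<i> * of_nat k * of_real t)" for t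
    unfolding cis_conv_exp exp_of_nat_mult[symmetric] by (simp add: mult_ac)
  have 1: "((\<lambda>t. exp (u * of_real t)) has_integral (\<epsilon> / X - 1) / u) {0..pi}"
    using has_integral_exp[OF uv(1), of 0 pi] ex by simp
  have 2: "((\<lambda>t. exp (v * of_real t)) has_integral (1 - \<epsilon> / X) / v) {-pi..0}"
    using has_integral_exp[OF uv(2), of "-pi" 0] ex by simp
  have 3: "((\<lambda>t. exp (u * of_real t)) has_integral (\<epsilon> / X - \<epsilon> * X) / u) {-pi..pi}"
    using has_integral_exp[OF uv(1), of "-pi" pi] ex by simp
  have 4: "((\<lambda>t. exp (v * of_real t)) has_integral (\<epsilon> * X - \<epsilon> / X) / v) {-pi..pi}"
    using has_integral_exp[OF uv(2), of "-pi" pi] ex by simp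
  have 5: "((\<lambda>t. cis t ^ k * exp (-(\<alpha> * of_real \<bar>t\<bar>))) has_integral (1 - \<epsilon> / X) / v + (\<epsilon> / X - 1) / u) {-pi..pi}"
  proof (rule has_integral_combine[of _ 0])
    show "((\<lambda>t. cis t ^ k * exp (-(\<alpha> * of_real \<bar>t\<bar>))) has_integral (1 - \<epsilon> / X) / v) {-pi..0}"
      by (rule has_integral_eq[OF _ 2]) (auto simp: cis v_def algebra_simps simp flip: exp_add)
    show "((\<lambda>t. cis t ^ k * exp (-(\<alpha> * of_real \<bar>t\<bar>))) has_integral (\<epsilon> / X - 1) / u) {0..pi}"
      by (rule has_integral_eq[OF _ 1]) (auto simp: cis u_def algebra_simps simp flip: exp_add)
  qed auto
  have "((\<lambda>t. of_real pi / \<alpha> * (cis t ^ k * exp (-(\<alpha> * of_real \<bar>t\<bar>)) + (exp (v * of_real t) + exp (u * of_real t)) / q))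
     has_integral of_real pi / \<alpha> * ((1 - \<epsilon> / X) / v + (\<epsilon> / X - 1) / u + ((\<epsilon> * X - \<epsilon> / X) / v + (\<epsilon> / X - \<epsilon> * X) / u) / q)) {-pi..pi}"
    by (intro has_integral_mult_right has_integral_add has_integral_divide 3 4 5)
  also have "(\<lambda>t. of_real pi / \<alpha> * (cis t ^ k * exp (-(\<alpha> * of_real \<bar>t\<bar>)) + (exp (v * of_real t) + exp (u * of_real t)) / q))
     = (\<lambda>t. cis t ^ k * resolvent_kernel \<alpha> t)"
  proof
    fix t
    have "exp (v * of_real t) = cis t ^ k * exp (\<alpha> * of_real t)" "exp (u * of_real t) = cis t ^ k * exp (-(\<alpha> * of_real t))"
      by (simp_all add: cis u_def v_def algebra_simps flip: exp_add)
    then show "of_real pi / \<alpha> * (cis t ^ k * exp (-(\<alpha> * of_real \<bar>t\<bar>)) + (exp (v * of_real t) + exp (u * of_real t)) / q)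
      = cis t ^ k * resolvent_kernel \<alpha> t"
      by (simp add: resolvent_kernel_def flip: q_def) (simp add: algebra_simps add_divide_distrib)
  qed
  also have "of_real pi / \<alpha> * ((1 - \<epsilon> / X) / v + (\<epsilon> / X - 1) / u + ((\<epsilon> * X - \<epsilon> / X) / v + (\<epsilon> / X - \<epsilon> * X) / u) / q)
    = 2 * of_real pi * (1 / ((of_nat k)\<^sup>2 + \<alpha>\<^sup>2))"
  proof -
    \<comment> \<open>Because \<open>q = X^2 - 1\<close>, the full-interval integrals divided by
      \<open>q\<close> match the endpoint terms of the two half-interval integrals.\<close>
    have "(\<epsilon> * X - \<epsilon> / X) / q = \<epsilon> / X"
      using X q unfolding qX by (simp add: field_simps power2_eq_square)
    then have *: "\<epsilon> * X - \<epsilon> / X = \<epsilon> / X * q" "\<epsilon> / X - \<epsilon> * X = - (\<epsilon> / X * q)"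
      using q by (simp_all add: field_simps)
    have "(1 - \<epsilon> / X) / v + (\<epsilon> / X - 1) / u + ((\<epsilon> * X - \<epsilon> / X) / v + (\<epsilon> / X - \<epsilon> * X) / u) / q = 1 / v - 1 / u"
      unfolding * using q uv by (simp add: diff_divide_distrib add_divide_distrib)
    also have "\<dots> = 2 * \<alpha> * (1 / ((of_nat k)\<^sup>2 + \<alpha>\<^sup>2))"
    proof -
      have "u - v = - 2 * \<alpha>" "u * v = - ((of_nat k)\<^sup>2 + \<alpha>\<^sup>2)"
        by (simp_all add: u_def v_def power2_eq_square algebra_simps)
      moreover have "1 / v - 1 / u = (u - v) / (u * v)" using uv by (simp add: divide_simps)
      ultimately show ?thesis by (simp only:) (simp add: minus_divide_right)
    qed
    finally show ?thesis using \<alpha> by simp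
  qed
  finally show "((\<lambda>t. cis t ^ k * resolvent_kernel \<alpha> t) has_integral 2 * of_real pi * (1 / ((of_nat k)\<^sup>2 + \<alpha>\<^sup>2))) {-pi..pi}" .
qed

section \<open>Integral and sum against \<open>1 / (x^2 + \<alpha>^2)\<close>\<close>

text \<open>Cauchy's formula gives the bound at once: for real \<open>x\<close> the exponential in
  it has modulus 1.\<close>

lemma gen_binomial_bounded:
  assumes "Re w > -1"
  obtains B where "\<And>x::real. norm (gen_binomial w (of_real x)) \<le> B" "B \<ge> 0"
proof -
  define B where "B = (\<integral>t. norm ((1 + cis t) powr w) \<partial>circ) / (2 * pi)"
  have "norm (gen_binomial w (of_real x)) \<le> B" for x
  proof -
    have "norm (binomial_integral w (of_real x)) \<le> (\<integral>t. norm ((1 + cis t) powr w * exp (-(\<i> * of_real x * of_real t))) \<partial>circ)"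
      unfolding binomial_integral_def by (rule integral_norm_bound)
    also have "\<dots> = (\<integral>t. norm ((1 + cis t) powr w) \<partial>circ)"
      by (simp add: norm_mult norm_exp_eq_Re)
    finally show ?thesis
      unfolding binomial_integral_eq[OF assms] B_def by (simp add: norm_mult field_simps)
  qed
  moreover have "B \<ge> 0" unfolding B_def by simp
  ultimately show ?thesis using that by blast
qed

lemma summable_gen_binomial_resolvent:
  assumes "Re w > -1" "Re \<alpha> > 0"
  shows "summable (\<lambda>k::nat. norm (gen_binomial w (of_nat k) * (1 / ((of_nat k)\<^sup>2 + \<alpha>\<^sup>2))))"
proof -
  obtain B where B: "\<And>x::real. norm (gen_binomial w (of_real x)) \<le> B" "B \<ge> 0"
    using gen_binomial_bounded[OF assms(1)] by blast
  obtain C where C: "\<And>x. norm (1 / ((complex_of_real x)\<^sup>2 + \<alpha>\<^sup>2)) \<le> C * inverse (1 + x\<^sup>2)" "C > 0"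
    using norm_inverse_square_plus_square_le[OF assms(2)] by blast
  show ?thesis
  proof (rule summable_comparison_test_ev)
    show "eventually (\<lambda>k. norm (norm (gen_binomial w (of_nat k) * (1 / ((of_nat k)\<^sup>2 + \<alpha>\<^sup>2)))) \<le> B * C * inverse (real k ^ 2)) sequentially"
      using eventually_gt_at_top[of 0]
    proof eventually_elim
      case (elim k)
      have "norm (1 / ((complex_of_real (real k))\<^sup>2 + \<alpha>\<^sup>2)) \<le> C * inverse (1 + (real k)\<^sup>2)" by (rule C)
      also have "\<dots> \<le> C * inverse ((real k)\<^sup>2)"
        using C(2) elim by (intro mult_left_mono le_imp_inverse_le) auto
      finally have "norm (gen_binomial w (of_real (real k)) * (1 / ((complex_of_real (real k))\<^sup>2 + \<alpha>\<^sup>2))) \<le> B * (C * inverse ((real k)\<^sup>2))"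
        unfolding norm_mult using B(1)[of "real k"] B(2) by (intro mult_mono) auto
      then show ?case by (simp add: mult.assoc)
    qed
    show "summable (\<lambda>k. B * C * inverse (real k ^ 2))"
      by (intro summable_mult inverse_power_summable) auto
  qed
qed

text \<open>Fubini applies since the modulus of the integrand is a product of an integrable function
  of \<open>x\<close> and one of \<open>t\<close>. One inner integral is Cauchy's formula, the other
  the Fourier transform.\<close>

lemma gen_binomial_resolvent_integral:
  assumes "Re w > -1" "Re \<alpha> > 0"
  shows "integrable lborel (\<lambda>x::real. gen_binomial w (of_real x) * (1 / ((of_real x)\<^sup>2 + \<alpha>\<^sup>2)))"
    and "2 * of_real pi * (\<integral>x. gen_binomial w (of_real x) * (1 / ((of_real x)\<^sup>2 + \<alpha>\<^sup>2)) \<partial>lborel)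
      = (\<integral>t. (1 + cis t) powr w * (of_real pi / \<alpha> * exp (-(\<alpha> * of_real \<bar>t\<bar>))) \<partial>circ)"
proof -
  obtain B where B: "\<And>x::real. norm (gen_binomial w (of_real x)) \<le> B"
    using gen_binomial_bounded[OF assms(1)] by blast
  have "continuous_on UNIV (\<lambda>x::real. gen_binomial w (of_real x))"
    unfolding gen_binomial_def by (intro continuous_intros continuous_on_compose2[OF continuous_on_rGamma[of UNIV]]) auto
  then have "(\<lambda>x::real. gen_binomial w (of_real x)) \<in> borel_measurable lborel"
    using borel_measurable_continuous_onI by simp
  from integrable_bounded_mult_inverse_square_plus_square[OF assms(2) this B]
  show "integrable lborel (\<lambda>x::real. gen_binomial w (of_real x) * (1 / ((of_real x)\<^sup>2 + \<alpha>\<^sup>2)))" .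
  interpret circ: finite_measure circ by (rule finite_measure_circ)
  interpret pair_sigma_finite lborel circ ..
  define D where "D = (\<lambda>x::real. 1 / ((complex_of_real x)\<^sup>2 + \<alpha>\<^sup>2))"
  define f where "f = (\<lambda>x t. (1 + cis t) powr w * exp (-(\<i> * of_real x * of_real t)) * D x)"
  have [measurable]: "complex_of_real \<in> borel_measurable circ" by (intro measurable_circ continuous_intros)
  have [measurable]: "(\<lambda>t. (1 + cis t) powr w) \<in> borel_measurable circ"
    using integrable_binomial_kernel[OF assms(1)] by (rule borel_measurable_integrable)
  have [measurable]: "D \<in> borel_measurable lborel" unfolding D_def by measurable
  have D: "integrable lborel D"
    using integrable_bounded_mult_inverse_square_plus_square[OF assms(2), of "\<lambda>_. 1" 1] by (simp add: D_def)
  have nf: "norm (f x t) = norm (D x) * norm ((1 + cis t) powr w)" for x t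
    by (simp add: f_def norm_mult norm_exp_eq_Re)
  have "integrable (lborel \<Otimes>\<^sub>M circ) (case_prod f)"
  proof (rule Fubini_integrable)
    show "case_prod f \<in> borel_measurable (lborel \<Otimes>\<^sub>M circ)"
      unfolding f_def by measurable
    show "integrable lborel (\<lambda>x. \<integral>t. norm (case_prod f (x, t)) \<partial>circ)"
      using D by (simp add: nf)
    show "AE x in lborel. integrable circ (\<lambda>t. case_prod f (x, t))"
      unfolding f_def by (auto intro!: integrable_binomial_integral assms)
  qed
  then have "(\<integral>t. (\<integral>x. f x t \<partial>lborel) \<partial>circ) = (\<integral>x. (\<integral>t. f x t \<partial>circ) \<partial>lborel)"
    by (rule Fubini_integral)
  also have "(\<lambda>x. \<integral>t. f x t \<partial>circ) = (\<lambda>x. 2 * of_real pi * (gen_binomial w (of_real x) * D x))"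
  proof
    fix x
    have "(\<integral>t. f x t \<partial>circ) = binomial_integral w (of_real x) * D x"
      unfolding f_def binomial_integral_def by (rule integral_mult_left_zero)
    then show "(\<integral>t. f x t \<partial>circ) = 2 * of_real pi * (gen_binomial w (of_real x) * D x)"
      by (simp add: binomial_integral_eq[OF assms(1)])
  qed
  also have "(\<lambda>t. \<integral>x. f x t \<partial>lborel) = (\<lambda>t. (1 + cis t) powr w * (of_real pi / \<alpha> * exp (-(\<alpha> * of_real \<bar>t\<bar>))))"
    unfolding f_def D_def
    using Fourier_inverse_square_plus_square[OF assms(2)] by (simp only: mult.assoc integral_mult_right_zero)
  finally show "2 * of_real pi * (\<integral>x. gen_binomial w (of_real x) * (1 / ((of_real x)\<^sup>2 + \<alpha>\<^sup>2)) \<partial>lborel)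
      = (\<integral>t. (1 + cis t) powr w * (of_real pi / \<alpha> * exp (-(\<alpha> * of_real \<bar>t\<bar>))) \<partial>circ)"
    by (simp only: D_def integral_mult_right_zero)
qed

section \<open>Abel summation of the binomial series\<close>

text \<open>The bound is uniform in \<open>r\<close> and integrable over \<open>circ\<close> when
  \<open>Re w > -1\<close>, so it dominates the limit as \<open>r\<close> tends to 1.\<close>

lemma norm_one_plus_scaled_cis_powr_le:
  assumes "0 \<le> r" "r \<le> 1" "t \<in> {-pi<..<pi}"
  shows "norm ((1 + of_real r * cis t) powr w) \<le> exp (\<bar>Im w\<bar> * pi) * (2 powr Re w + cos (t / 2) powr Re w)"
proof -
  define z where "z = 1 + of_real r * cis t"
  have "norm z \<le> 1 + norm (of_real r * cis t)" unfolding z_def using norm_triangle_ineq[of 1 "of_real r * cis t"] by simp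
  then have le: "norm z \<le> 2" using assms by (simp add: norm_mult)
  \<comment> \<open>The points \<open>z\<close> and \<open>1 + cis t\<close> are at distance
    \<open>1 - r\<close>, which is itself at most \<open>norm z\<close>; hence
    \<open>2 * cos (t / 2)\<close> is at most twice \<open>norm z\<close>.\<close>
  have ge: "cos (t / 2) \<le> norm z"
  proof -
    have "1 + r * cos t \<le> norm z" using complex_Re_le_cmod[of z] by (simp add: z_def)
    moreover have "r * cos t \<ge> - r" using mult_left_mono[OF cos_ge_minus_one[of t] assms(1)] by simp
    ultimately have "1 - r \<le> norm z" by linarith
    have "2 * cos (t / 2) = norm (z + of_real (1 - r) * cis t)"
      using norm_one_plus_cis[OF assms(3)] by (simp add: z_def algebra_simps)
    also have "\<dots> \<le> norm z + norm (of_real (1 - r) * cis t)" by (rule norm_triangle_ineq)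
    also have "norm (of_real (1 - r) * cis t) = 1 - r" using assms by (simp only: norm_mult norm_of_real norm_cis) simp
    finally show ?thesis using \<open>1 - r \<le> norm z\<close> by simp
  qed
  \<comment> \<open>The two summands cover the cases \<open>Re w \<ge> 0\<close> and \<open>Re w < 0\<close>.\<close>
  have "norm z powr Re w \<le> 2 powr Re w + cos (t / 2) powr Re w"
  proof (cases "Re w \<ge> 0")
    case True
    then have "norm z powr Re w \<le> 2 powr Re w" using le by (intro powr_mono2) auto
    then show ?thesis by (simp add: add_increasing2)
  next
    case False
    then have "norm z powr Re w \<le> cos (t / 2) powr Re w"
      using ge cos_half_pos[OF assms(3)] by (intro powr_mono2') auto
    then show ?thesis by (simp add: add_increasing)
  qed
  then have "exp (\<bar>Im w\<bar> * pi) * norm z powr Re w \<le> exp (\<bar>Im w\<bar> * pi) * (2 powr Re w + cos (t / 2) powr Re w)"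
    by (intro mult_left_mono) auto
  then show ?thesis unfolding z_def by (rule order_trans[OF norm_powr_complex_le])
qed

text \<open>For \<open>r < 1\<close> the binomial series has the geometric majorant
  \<open>B * norm (g t) * r ^ k\<close>, which permits termwise integration.\<close>

lemma gen_binomial_series_integral:
  fixes g :: "real \<Rightarrow> complex"
  assumes w: "Re w > -1" and g: "continuous_on {-pi..pi} g" and r: "0 \<le> r" "r < 1"
  shows "(\<lambda>k. gen_binomial w (of_nat k) * of_real r ^ k * (\<integral>t. cis t ^ k * g t \<partial>circ)) sums
     (\<integral>t. (1 + of_real r * cis t) powr w * g t \<partial>circ)"
proof -
  obtain B where B: "\<And>x::real. norm (gen_binomial w (of_real x)) \<le> B" "B \<ge> 0"
    using gen_binomial_bounded[OF w] by blast
  have B': "norm (gen_binomial w (of_nat k)) \<le> B" for k using B(1)[of "real k"] by simp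
  have w1: "w + 1 \<notin> \<int>\<^sub>\<le>\<^sub>0" using w by (auto elim!: nonpos_Ints_cases simp: complex_eq_iff)
  have ig: "integrable circ g" using g by (rule integrable_circ_continuous)
  define f where "f = (\<lambda>k t. gen_binomial w (of_nat k) * of_real r ^ k * (cis t ^ k * g t))"
  have fle: "norm (f k t) \<le> B * norm (g t) * r ^ k" for k t
  proof -
    have "norm (f k t) = norm (gen_binomial w (of_nat k)) * (r ^ k * norm (g t))"
      using r by (simp add: f_def norm_mult norm_power)
    also have "\<dots> \<le> B * (r ^ k * norm (g t))" using r by (intro mult_right_mono B') auto
    finally show ?thesis by (simp add: mult_ac)
  qed
  have fi: "integrable circ (f k)" for k
    unfolding f_def by (intro integrable_mult_right integrable_circ_continuous continuous_intros g)
  have "(\<lambda>k. integral\<^sup>L circ (f k)) sums (\<integral>t. (\<Sum>k. f k t) \<partial>circ)"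
  proof (rule sums_integral[OF fi])
    show "AE t in circ. summable (\<lambda>k. norm (f k t))"
    proof (rule AE_I2)
      fix t
      show "summable (\<lambda>k. norm (f k t))"
        by (rule summable_comparison_test'[of "\<lambda>k. B * norm (g t) * r ^ k" 0])
           (use fle r in \<open>auto intro!: summable_mult summable_geometric\<close>)
    qed
    show "summable (\<lambda>k. \<integral>t. norm (f k t) \<partial>circ)"
    proof (rule summable_comparison_test'[of "\<lambda>k. (B * (\<integral>t. norm (g t) \<partial>circ)) * r ^ k" 0])
      fix k :: nat
      have "(\<integral>t. norm (f k t) \<partial>circ) \<le> (\<integral>t. B * norm (g t) * r ^ k \<partial>circ)"
        by (intro integral_mono fle) (use fi ig in auto)
      then show "norm (\<integral>t. norm (f k t) \<partial>circ) \<le> (B * (\<integral>t. norm (g t) \<partial>circ)) * r ^ k" by simp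
    qed (use r in \<open>auto intro!: summable_mult summable_geometric\<close>)
  qed
  also have "(\<lambda>t. \<Sum>k. f k t) = (\<lambda>t. (1 + of_real r * cis t) powr w * g t)"
  proof
    fix t
    have "(\<lambda>k. (w gchoose k) * (of_real r * cis t) ^ k * g t) sums ((1 + of_real r * cis t) powr w * g t)"
      using r by (intro sums_mult2 gen_binomial_complex) (simp add: norm_mult)
    then show "(\<Sum>k. f k t) = (1 + of_real r * cis t) powr w * g t"
      by (simp add: f_def gen_binomial_of_nat[OF w1] power_mult_distrib mult.assoc sums_iff)
  qed
  finally show ?thesis by (simp add: f_def mult.assoc)
qed

text \<open>Let \<open>r\<close> tend to 1 in the termwise integrated series: Tannery's theorem
  handles the absolutely convergent sum, dominated convergence the integral.\<close>

lemma gen_binomial_resolvent_sum: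
  assumes w: "Re w > -1" and \<alpha>: "Re \<alpha> > 0"
  shows "2 * of_real pi * (\<Sum>k. gen_binomial w (of_nat k) * (1 / ((of_nat k)\<^sup>2 + \<alpha>\<^sup>2)))
    = (\<integral>t. (1 + cis t) powr w * resolvent_kernel \<alpha> t \<partial>circ)"
proof -
  define a where "a = (\<lambda>k. 2 * of_real pi * (gen_binomial w (of_nat k) * (1 / ((of_nat k)\<^sup>2 + \<alpha>\<^sup>2))))"
  \<comment> \<open>A sequence in \<open>[0, 1)\<close> tending to 1, as dominated convergence is
    applied along sequences; \<open>Suc n\<close> avoids division by 0.\<close>
  define r where "r = (\<lambda>n::nat. 1 - 1 / real (Suc n))"
  have r: "0 \<le> r n" "r n < 1" for n by (auto simp: r_def field_simps)
  have r_lim: "r \<longlonglongrightarrow> 1"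
    unfolding r_def using LIMSEQ_Suc[OF lim_1_over_n[where 'a = real]] tendsto_diff[OF tendsto_const, of _ 0 sequentially 1] by simp
  have sumr: "(\<Sum>k. a k * of_real (r n) ^ k) = (\<integral>t. (1 + of_real (r n) * cis t) powr w * resolvent_kernel \<alpha> t \<partial>circ)" for n
  proof -
    have "(\<lambda>k. gen_binomial w (of_nat k) * of_real (r n) ^ k * (2 * of_real pi * (1 / ((of_nat k)\<^sup>2 + \<alpha>\<^sup>2)))) sums
      (\<integral>t. (1 + of_real (r n) * cis t) powr w * resolvent_kernel \<alpha> t \<partial>circ)"
      using gen_binomial_series_integral[OF w continuous_on_resolvent_kernel[of _ \<alpha>] r(1)[of n] r(2)[of n]]
      unfolding resolvent_kernel_Fourier_coefficient[OF \<alpha>] .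
    then show ?thesis by (simp add: a_def sums_iff mult_ac)
  qed
  have suma: "summable (\<lambda>k. norm (a k))"
    unfolding a_def norm_mult[of "2 * of_real pi"] by (intro summable_mult summable_gen_binomial_resolvent w \<alpha>)
  have Abel: "(\<lambda>n. \<Sum>k. a k * of_real (r n) ^ k) \<longlonglongrightarrow> (\<Sum>k. a k * 1 ^ k)"
  proof (rule tannerys_theorem[THEN conjunct2, THEN conjunct2])
    show "(\<lambda>n. a k * of_real (r n) ^ k) \<longlonglongrightarrow> a k * 1 ^ k" for k
      using r_lim by (intro tendsto_intros) (use tendsto_of_real[OF r_lim] in simp)
    have "norm (a k * of_real (r n) ^ k) \<le> norm (a k)" for k n
      using r[of n] by (simp add: norm_mult norm_power mult_left_le power_le_one)
    then show "eventually (\<lambda>(k, n). norm (a k * of_real (r n) ^ k) \<le> norm (a k)) (at_top \<times>\<^sub>F sequentially)"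
      by (intro always_eventually) auto
  qed (use suma in auto)
  have "compact (resolvent_kernel \<alpha> ` {-pi..pi})"
    by (intro compact_continuous_image continuous_on_resolvent_kernel) auto
  then obtain M where M: "\<And>t. t \<in> {-pi..pi} \<Longrightarrow> norm (resolvent_kernel \<alpha> t) \<le> M"
    by (meson bounded_iff compact_imp_bounded imageI)
  have "(\<lambda>n. \<Sum>k. a k * of_real (r n) ^ k) \<longlonglongrightarrow> (\<integral>t. (1 + cis t) powr w * resolvent_kernel \<alpha> t \<partial>circ)"
    unfolding sumr
  proof (rule integral_dominated_convergence)
    have [measurable]: "resolvent_kernel \<alpha> \<in> borel_measurable circ"
      by (intro measurable_circ continuous_on_resolvent_kernel)
    have [measurable]: "(\<lambda>t. (1 + cis t) powr w) \<in> borel_measurable circ"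
      using measurable_circ[OF continuous_on_binomial_kernel[of 1 w]] by simp
    have [measurable]: "(\<lambda>t. (1 + of_real (r n) * cis t) powr w) \<in> borel_measurable circ" for n
      using r[of n] by (intro measurable_circ continuous_on_binomial_kernel) auto
    show "(\<lambda>t. (1 + cis t) powr w * resolvent_kernel \<alpha> t) \<in> borel_measurable circ" by measurable
    show "(\<lambda>t. (1 + of_real (r n) * cis t) powr w * resolvent_kernel \<alpha> t) \<in> borel_measurable circ" for n by measurable
    show "integrable circ (\<lambda>t. exp (\<bar>Im w\<bar> * pi) * (2 powr Re w + cos (t / 2) powr Re w) * M)"
      by (intro integrable_mult_left integrable_mult_right Bochner_Integration.integrable_add
          integrable_circ_cos_powr w finite_measure.integrable_const finite_measure_circ)
    show "AE t in circ. norm ((1 + of_real (r n) * cis t) powr w * resolvent_kernel \<alpha> t)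
        \<le> exp (\<bar>Im w\<bar> * pi) * (2 powr Re w + cos (t / 2) powr Re w) * M" for n
    proof (rule AE_I2)
      fix t assume "t \<in> space circ"
      then have t: "t \<in> {-pi<..<pi}" by simp
      show "norm ((1 + of_real (r n) * cis t) powr w * resolvent_kernel \<alpha> t)
        \<le> exp (\<bar>Im w\<bar> * pi) * (2 powr Re w + cos (t / 2) powr Re w) * M"
        unfolding norm_mult using t r[of n]
        by (intro mult_mono norm_one_plus_scaled_cis_powr_le M) auto
    qed
    show "AE t in circ. (\<lambda>n. (1 + of_real (r n) * cis t) powr w * resolvent_kernel \<alpha> t)
       \<longlonglongrightarrow> (1 + cis t) powr w * resolvent_kernel \<alpha> t"
    proof (rule AE_I2)
      fix t assume "t \<in> space circ"
      then have "1 + 1 * cis t \<notin> \<real>\<^sub>\<le>\<^sub>0" using one_plus_cis_notin[of t 1] by simp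
      moreover have "(\<lambda>n. complex_of_real (r n)) \<longlonglongrightarrow> 1" using tendsto_of_real[OF r_lim] by simp
      ultimately have "(\<lambda>n. (1 + of_real (r n) * cis t) powr w * resolvent_kernel \<alpha> t)
          \<longlonglongrightarrow> (1 + 1 * cis t) powr w * resolvent_kernel \<alpha> t"
        by (intro tendsto_intros tendsto_powr_complex)
      then show "(\<lambda>n. (1 + of_real (r n) * cis t) powr w * resolvent_kernel \<alpha> t)
          \<longlonglongrightarrow> (1 + cis t) powr w * resolvent_kernel \<alpha> t" by simp
    qed
  qed
  then have "(\<Sum>k. a k * 1 ^ k) = (\<integral>t. (1 + cis t) powr w * resolvent_kernel \<alpha> t \<partial>circ)"
    by (rule LIMSEQ_unique[OF Abel])
  moreover have "(\<Sum>k. a k) = 2 * of_real pi * (\<Sum>k. gen_binomial w (of_nat k) * (1 / ((of_nat k)\<^sup>2 + \<alpha>\<^sup>2)))"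
    unfolding a_def by (intro suminf_mult summable_norm_cancel[OF summable_gen_binomial_resolvent] w \<alpha>)
  ultimately show ?thesis by simp
qed

theorem mainTheorem9:
  fixes w \<alpha> :: complex
  assumes "Re w > -1" and "Re \<alpha> > 0"
  shows "integrable lborel (\<lambda>x::real. gen_binomial w (of_real x) * (1 / ((of_real x)\<^sup>2 + \<alpha>\<^sup>2)))
    \<and> summable (\<lambda>k::nat. gen_binomial w (of_nat k) * (1 / ((of_nat k)\<^sup>2 + \<alpha>\<^sup>2)))
    \<and> (LINT x|lborel. gen_binomial w (of_real x) * (1 / ((of_real x)\<^sup>2 + \<alpha>\<^sup>2)))
      = (\<Sum>k::nat. gen_binomial w (of_nat k) * (1 / ((of_nat k)\<^sup>2 + \<alpha>\<^sup>2)))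
        - of_real pi / (\<alpha> * (exp (2 * of_real pi * \<alpha>) - 1))
          * (gen_binomial w (\<i> * \<alpha>) + gen_binomial w (- \<i> * \<alpha>))"
proof (intro conjI)
  show "integrable lborel (\<lambda>x::real. gen_binomial w (of_real x) * (1 / ((of_real x)\<^sup>2 + \<alpha>\<^sup>2)))"
    by (rule gen_binomial_resolvent_integral[OF assms])
  show "summable (\<lambda>k::nat. gen_binomial w (of_nat k) * (1 / ((of_nat k)\<^sup>2 + \<alpha>\<^sup>2)))"
    by (rule summable_norm_cancel[OF summable_gen_binomial_resolvent[OF assms]])
  define K where "K = (\<lambda>t. (1 + cis t) powr w)"
  define E where "E = (\<lambda>t. of_real pi / \<alpha> * exp (-(\<alpha> * complex_of_real \<bar>t\<bar>)))"
  define q where "q = exp (2 * of_real pi * \<alpha>) - 1"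
  define c where "c = of_real pi / (\<alpha> * q)"
  define P where "P = (\<lambda>z t. K t * exp (-(\<i> * z * complex_of_real t)))"
  have P: "integrable circ (P z)" for z
    unfolding P_def K_def by (rule integrable_binomial_integral[OF assms(1)])
  have KE: "integrable circ (\<lambda>t. K t * E t)"
    unfolding K_def E_def
    by (intro integrable_circ_mult_bounded integrable_binomial_kernel assms continuous_on_mult continuous_on_const
        continuous_on_exp continuous_on_minus continuous_on_of_real continuous_on_rabs continuous_on_id)
  \<comment> \<open>The two exponentials in the difference of the kernels are the Cauchy
    exponentials at \<open>z = \<i> * \<alpha>\<close> and
    \<open>z = - \<i> * \<alpha>\<close>.\<close>
  have "K t * resolvent_kernel \<alpha> t = K t * E t + c * (P (\<i> * \<alpha>) t + P (- \<i> * \<alpha>) t)" for t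
  proof -
    have "exp (-(\<i> * (\<i> * \<alpha>) * complex_of_real t)) = exp (\<alpha> * of_real t)"
         "exp (-(\<i> * (- \<i> * \<alpha>) * complex_of_real t)) = exp (-(\<alpha> * of_real t))"
      by (simp_all flip: mult.assoc)
    then show ?thesis
      unfolding resolvent_kernel_def P_def E_def c_def q_def[symmetric]
      by (simp add: divide_inverse distrib_left distrib_right mult_ac)
  qed
  moreover have IP: "integral\<^sup>L circ (P z) = 2 * of_real pi * gen_binomial w z" for z
    using binomial_integral_eq[OF assms(1)] by (simp add: P_def K_def binomial_integral_def)
  ultimately have "(\<integral>t. K t * resolvent_kernel \<alpha> t \<partial>circ)
      = (\<integral>t. K t * E t + c * (P (\<i> * \<alpha>) t + P (- \<i> * \<alpha>) t) \<partial>circ)" by simp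
  also have "\<dots> = (\<integral>t. K t * E t \<partial>circ) + c * (integral\<^sup>L circ (P (\<i> * \<alpha>)) + integral\<^sup>L circ (P (- \<i> * \<alpha>)))"
    using KE P by simp
  finally have "2 * of_real pi * (\<Sum>k. gen_binomial w (of_nat k) * (1 / ((of_nat k)\<^sup>2 + \<alpha>\<^sup>2)))
    = 2 * of_real pi * (\<integral>x. gen_binomial w (of_real x) * (1 / ((of_real x)\<^sup>2 + \<alpha>\<^sup>2)) \<partial>lborel)
     + c * (2 * of_real pi * gen_binomial w (\<i> * \<alpha>) + 2 * of_real pi * gen_binomial w (- \<i> * \<alpha>))"
    unfolding gen_binomial_resolvent_sum[OF assms] gen_binomial_resolvent_integral(2)[OF assms] IP K_def E_def .
  also have "\<dots> = 2 * of_real pi * ((\<integral>x. gen_binomial w (of_real x) * (1 / ((of_real x)\<^sup>2 + \<alpha>\<^sup>2)) \<partial>lborel)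
     + c * (gen_binomial w (\<i> * \<alpha>) + gen_binomial w (- \<i> * \<alpha>)))"
    by (simp only: distrib_left mult.left_commute)
  finally have "(\<Sum>k. gen_binomial w (of_nat k) * (1 / ((of_nat k)\<^sup>2 + \<alpha>\<^sup>2)))
    = (\<integral>x. gen_binomial w (of_real x) * (1 / ((of_real x)\<^sup>2 + \<alpha>\<^sup>2)) \<partial>lborel)
     + c * (gen_binomial w (\<i> * \<alpha>) + gen_binomial w (- \<i> * \<alpha>))"
    by (rule mult_left_cancel[THEN iffD1, rotated]) simp
  then show "(LINT x|lborel. gen_binomial w (of_real x) * (1 / ((of_real x)\<^sup>2 + \<alpha>\<^sup>2)))
      = (\<Sum>k::nat. gen_binomial w (of_nat k) * (1 / ((of_nat k)\<^sup>2 + \<alpha>\<^sup>2)))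
        - of_real pi / (\<alpha> * (exp (2 * of_real pi * \<alpha>) - 1))
          * (gen_binomial w (\<i> * \<alpha>) + gen_binomial w (- \<i> * \<alpha>))"
    unfolding c_def q_def by (simp only: eq_diff_eq)
qed

end
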